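(* Let $n\ge1$, let $\theta$ be a real skew-symmetric $n\times n$ matrix, let $k\in\mathbb{N}$ satisfy $k>n/2$, let $q\in\mathbb{N}$, and let $$\mathcal{P}(u)=\sum_{\nu=0}^q\sum_{\mu=1}^{N_\nu}b_{\nu,\mu,0}\,u\,b_{\nu,\mu,1}\,u\cdots u\,b_{\nu,\mu,\nu}$$ be a noncommutative polynomial (the term with $\nu=0$ being $b_{0,\mu,0}$) all of whose coefficients $b_{\nu,\mu,j}$ belong to $H^{k+r}_\theta$ for every $r\in\mathbb{N}$. If $u_0\in H^k_\theta$, then the mild solution $u$ of $$\partial_tu+Lu=\mathcal{P}(u),\qquad u(0)=u_0,$$ with maximal existence time $T_{\max}$ in $H^k_\theta$, satisfies $$u\in C((0,T];H^{k+r}_\theta)$$ for every $r\in\mathbb{N}$ and every $0<T<T_{\max}$.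
   Context: $\mathbb{N}=\{1,2,\dots\}$; the $N_\nu$ are finite nonnegative integers. Let $\theta=(\theta_{jk})$ be a real skew-symmetric $n\times n$ matrix. Let $U_1,\dots,U_n$ be unitaries with $U_kU_j=e^{2\pi i\theta_{kj}}U_jU_k$, realized in the standard representation on $\ell^2(\mathbb{Z}^n)$ (with canonical basis $(e_m)$): $U_je_m=e^{2\pi i\sum_{l<j}\theta_{jl}m_l}e_{m+\epsilon_j}$, where $\epsilon_j$ is the $j$-th unit vector. The noncommutative torus $\mathbb{T}_\theta^n=L^\infty(\mathbb{T}_\theta^n)$ is the von Neumann algebra they generate. For $m\in\mathbb{Z}^n$ put $U^m=U_1^{m_1}\cdots U_n^{m_n}$. The smooth algebra $\mathcal{A}_\theta^\infty$ is the set of all series $\sum_mc_mU^m$ with rapidly decreasing coefficients. The canonical trace $\tau$ is the faithful normal tracial state with $\tau(\sum c_mU^m)=c_0$ on $\mathcal{A}_\theta^\infty$. $L^2(\mathbb{T}_\theta^n)$ is the completion of $\mathcal{A}_\theta^\infty$ for $\|a\|_{L^2}=\tau(|a|^2)^{1/2}$; $\{U^m\}$ is an orthonormal basis of it, and $\widehat a(m)=\tau((U^m)^*a)$ are the Fourier coefficients. For $s\ge0$, $H^s_\theta$ is the set of $a\in L^2(\mathbb{T}_\theta^n)$ with $\|a\|_{H^s_\theta}^2=\sum_{m\in\mathbb{Z}^n}(1+4\pi^2|m|^2)^s|\widehat a(m)|^2<\infty$, where $|m|^2=m_1^2+\cdots+m_n^2$. For $k>n/2$ one has $H^k_\theta\subset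 L^\infty(\mathbb{T}_\theta^n)$ (inside $L^2(\mathbb{T}_\theta^n)$), and products are taken in $L^\infty(\mathbb{T}_\theta^n)$ (the product of two elements of $H^k_\theta$ is again in $H^k_\theta$). The Laplacian $L$ acts by $L(U^m)=4\pi^2|m|^2U^m$, and the heat semigroup $P_t=e^{-tL}$ by $\widehat{P_ta}(m)=e^{-4\pi^2|m|^2t}\widehat a(m)$. A mild solution on $[0,T]$ is a function $u\in C([0,T];H^k_\theta)$ with $u(t)=P_tu_0+\int_0^tP_{t-s}\mathcal{P}(u(s))\,ds$ for $0\le t\le T$ (Bochner integral in $H^k_\theta$). $T_{\max}\in(0,\infty]$ is the supremum of all $T>0$ for which a mild solution in $C([0,T];H^k_\theta)$ with initial datum $u_0$ exists; mild solutions are unique, and $u$ denotes the mild solution on $[0,T_{\max})$. *)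

theory Defs
  imports "HOL-Analysis.Analysis"
begin

section \<open>The Hilbert space of square-summable families\<close>

typedef 'i ell2 = "{f :: 'i \<Rightarrow> complex. (\<lambda>i. (cmod (f i))\<^sup>2) summable_on UNIV}"
  morphisms coord Abs_ell2
  by (rule exI[of _ "\<lambda>_. 0"]) auto

setup_lifting type_definition_ell2

lemma square_summable_add:
  fixes f g :: "'i \<Rightarrow> complex"
  assumes "(\<lambda>i. (cmod (f i))\<^sup>2) summable_on UNIV" "(\<lambda>i. (cmod (g i))\<^sup>2) summable_on UNIV"
  shows "(\<lambda>i. (cmod (f i + g i))\<^sup>2) summable_on UNIV"
proof (rule summable_on_comparison_test)
  show "(\<lambda>i. 2 * (cmod (f i))\<^sup>2 + 2 * (cmod (g i))\<^sup>2) summable_on UNIV"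
    by (intro summable_on_add summable_on_cmult_right assms)
  fix i
  have "(cmod (f i + g i))\<^sup>2 \<le> (cmod (f i) + cmod (g i))\<^sup>2"
    by (intro power_mono norm_triangle_ineq) auto
  also have "\<dots> \<le> 2 * (cmod (f i))\<^sup>2 + 2 * (cmod (g i))\<^sup>2"
    using sum_squares_bound[of "cmod (f i)" "cmod (g i)"] by (simp add: power2_sum)
  finally show "(cmod (f i + g i))\<^sup>2 \<le> 2 * (cmod (f i))\<^sup>2 + 2 * (cmod (g i))\<^sup>2" .
qed auto

lemma square_summable_cmult:
  fixes f :: "'i \<Rightarrow> complex"
  assumes "(\<lambda>i. (cmod (f i))\<^sup>2) summable_on UNIV"
  shows "(\<lambda>i. (cmod (c * f i))\<^sup>2) summable_on UNIV"
  using summable_on_cmult_right[OF assms, of "(cmod c)\<^sup>2"]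
  by (simp add: norm_mult power_mult_distrib)

lemma square_summable_cinner:
  fixes f g :: "'i \<Rightarrow> complex"
  assumes "(\<lambda>i. (cmod (f i))\<^sup>2) summable_on UNIV" "(\<lambda>i. (cmod (g i))\<^sup>2) summable_on UNIV"
  shows "(\<lambda>i. cnj (f i) * g i) summable_on UNIV"
proof -
  have "(\<lambda>i. cmod (cnj (f i) * g i)) summable_on UNIV"
  proof (rule summable_on_comparison_test)
    show "(\<lambda>i. (cmod (f i))\<^sup>2 + (cmod (g i))\<^sup>2) summable_on UNIV"
      by (intro summable_on_add assms)
    fix i
    have "0 \<le> cmod (f i) * cmod (g i)" by simp
    moreover have "2 * (cmod (f i) * cmod (g i)) \<le> (cmod (f i))\<^sup>2 + (cmod (g i))\<^sup>2"
      using sum_squares_bound[of "cmod (f i)" "cmod (g i)"] by (simp add: mult.assoc)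
    ultimately show "cmod (cnj (f i) * g i) \<le> (cmod (f i))\<^sup>2 + (cmod (g i))\<^sup>2"
      unfolding norm_mult complex_mod_cnj by linarith
  qed auto
  then show ?thesis by (rule abs_summable_summable)
qed

instantiation ell2 :: (type) real_vector
begin
lift_definition zero_ell2 :: "'a ell2" is "\<lambda>_. 0" by simp
lift_definition plus_ell2 :: "'a ell2 \<Rightarrow> 'a ell2 \<Rightarrow> 'a ell2" is "\<lambda>f g i. f i + g i"
  by (rule square_summable_add)
lift_definition uminus_ell2 :: "'a ell2 \<Rightarrow> 'a ell2" is "\<lambda>f i. - f i" by simp
lift_definition minus_ell2 :: "'a ell2 \<Rightarrow> 'a ell2 \<Rightarrow> 'a ell2" is "\<lambda>f g i. f i - g i"
  subgoal for f g using square_summable_add[of f "\<lambda>i. - g i"] by simp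
  done
lift_definition scaleR_ell2 :: "real \<Rightarrow> 'a ell2 \<Rightarrow> 'a ell2" is "\<lambda>r f i. of_real r * f i"
  by (rule square_summable_cmult)
instance
  by standard (transfer; auto simp: algebra_simps)+
end

lift_definition scaleC :: "complex \<Rightarrow> 'i ell2 \<Rightarrow> 'i ell2" is "\<lambda>c f i. c * f i"
  by (rule square_summable_cmult)

text \<open>The complex inner product is antilinear in its first argument.\<close>

definition cinner :: "'i ell2 \<Rightarrow> 'i ell2 \<Rightarrow> complex" where
  "cinner x y = (\<Sum>\<^sub>\<infinity>i. cnj (coord x i) * coord y i)"

lemma coord_square_summable: "(\<lambda>i. (cmod (coord x i))\<^sup>2) summable_on UNIV"
  using coord[of x] by simp

lemma cinner_summable: "(\<lambda>i. cnj (coord x i) * coord y i) summable_on UNIV"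
  by (intro square_summable_cinner coord_square_summable)

lemma cinner_self: "cinner x x = of_real (\<Sum>\<^sub>\<infinity>i. (cmod (coord x i))\<^sup>2)"
proof -
  have "cinner x x = (\<Sum>\<^sub>\<infinity>i. of_real ((cmod (coord x i))\<^sup>2))"
    unfolding cinner_def
    by (intro infsum_cong) (metis complex_norm_square mult.commute of_real_power)
  also have "\<dots> = of_real (\<Sum>\<^sub>\<infinity>i. (cmod (coord x i))\<^sup>2)"
    by (rule infsumI) (intro has_sum_of_real has_sum_infsum coord_square_summable)
  finally show ?thesis .
qed

instantiation ell2 :: (type) real_inner
begin
definition inner_ell2 :: "'a ell2 \<Rightarrow> 'a ell2 \<Rightarrow> real" where "inner_ell2 x y = Re (cinner x y)"
definition norm_ell2 :: "'a ell2 \<Rightarrow> real" where "norm_ell2 x = sqrt (inner x x)"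
definition sgn_ell2 :: "'a ell2 \<Rightarrow> 'a ell2" where "sgn_ell2 x = x /\<^sub>R norm x"
definition dist_ell2 :: "'a ell2 \<Rightarrow> 'a ell2 \<Rightarrow> real" where "dist_ell2 x y = norm (x - y)"
definition uniformity_ell2 :: "('a ell2 \<times> 'a ell2) filter" where
  "uniformity_ell2 = (INF e\<in>{0<..}. principal {(x, y). dist x y < e})"
definition open_ell2 :: "'a ell2 set \<Rightarrow> bool" where
  "open_ell2 S \<longleftrightarrow> (\<forall>x\<in>S. \<forall>\<^sub>F (x', y) in uniformity. x' = x \<longrightarrow> y \<in> S)"
instance
proof
  fix x y z :: "'a ell2" and r :: real and S :: "'a ell2 set"
  have cnj_cinner: "cnj (cinner x y) = cinner y x" for x y :: "'a ell2"
    unfolding cinner_def by (simp add: infsum_cnj[symmetric] mult.commute)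
  show "inner x y = inner y x"
    unfolding inner_ell2_def cnj_cinner[symmetric, of x y] by simp
  have "cinner (x + y) z = cinner x z + cinner y z"
    unfolding cinner_def plus_ell2.rep_eq
    by (subst infsum_add[symmetric]) (auto intro!: cinner_summable simp: distrib_right)
  then show "inner (x + y) z = inner x z + inner y z" by (simp add: inner_ell2_def)
  have "cinner (r *\<^sub>R x) y = of_real r * cinner x y"
    unfolding cinner_def scaleR_ell2.rep_eq
    by (subst infsum_cmult_right[symmetric]) (auto intro!: cinner_summable simp: mult.assoc)
  then show "inner (r *\<^sub>R x) y = r * inner x y" by (simp add: inner_ell2_def)
  have self: "inner x x = (\<Sum>\<^sub>\<infinity>i. (cmod (coord x i))\<^sup>2)"
    by (simp add: inner_ell2_def cinner_self)
  show "0 \<le> inner x x" unfolding self by (intro infsum_nonneg) auto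
  show "inner x x = 0 \<longleftrightarrow> x = 0"
  proof
    assume "inner x x = 0"
    then have "(cmod (coord x i))\<^sup>2 = 0" for i
      using nonneg_infsum_le_0D[OF _ coord_square_summable[of x], of i] self by simp
    then show "x = 0" by transfer auto
  next
    assume "x = 0"
    then show "inner x x = 0" unfolding self by (simp add: zero_ell2.rep_eq)
  qed
qed (rule norm_ell2_def sgn_ell2_def dist_ell2_def uniformity_ell2_def open_ell2_def)+
end

lemma norm_ell2_square: "(norm x)\<^sup>2 = (\<Sum>\<^sub>\<infinity>i. (cmod (coord x i))\<^sup>2)"
  by (simp add: power2_norm_eq_inner inner_ell2_def cinner_self)

lemma sum_coord_le_norm: "finite F \<Longrightarrow> (\<Sum>i\<in>F. (cmod (coord x i))\<^sup>2) \<le> (norm x)\<^sup>2"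
  unfolding norm_ell2_square by (intro finite_sum_le_infsum coord_square_summable) auto

lemma coord_le_norm: "cmod (coord x i) \<le> norm x"
  using sum_coord_le_norm[of "{i}" x] by (simp add: power2_le_iff_abs_le)

instance ell2 :: (type) banach
proof
  fix X :: "nat \<Rightarrow> 'a ell2"
  assume X: "Cauchy X"
  have Cauchy_coord: "Cauchy (\<lambda>p. coord (X p) i)" for i
  proof (rule metric_CauchyI)
    fix e :: real assume "e > 0"
    then obtain M where M: "\<And>p r. p \<ge> M \<Longrightarrow> r \<ge> M \<Longrightarrow> dist (X p) (X r) < e"
      using metric_CauchyD[OF X] by blast
    have "dist (coord (X p) i) (coord (X r) i) \<le> dist (X p) (X r)" for p r
      using coord_le_norm[of "X p - X r" i] by (simp add: minus_ell2.rep_eq dist_norm)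
    then show "\<exists>M. \<forall>p\<ge>M. \<forall>r\<ge>M. dist (coord (X p) i) (coord (X r) i) < e"
      using M by (meson le_less_trans)
  qed
  have "\<forall>i. \<exists>l. (\<lambda>p. coord (X p) i) \<longlonglongrightarrow> l"
    using Cauchy_convergent[OF Cauchy_coord] unfolding convergent_def by blast
  from choice[OF this] obtain f where f: "\<And>i. (\<lambda>p. coord (X p) i) \<longlonglongrightarrow> f i"
    by blast
  have bound: "(\<Sum>i\<in>F. (cmod (coord (X p) i - f i))\<^sup>2) \<le> e\<^sup>2"
    if "finite F" "\<And>r. r \<ge> M \<Longrightarrow> dist (X p) (X r) < e" for F p M e
  proof (rule tendsto_upperbound)
    show "(\<lambda>r. \<Sum>i\<in>F. (cmod (coord (X p) i - coord (X r) i))\<^sup>2)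
            \<longlonglongrightarrow> (\<Sum>i\<in>F. (cmod (coord (X p) i - f i))\<^sup>2)"
      by (intro tendsto_intros f)
    show "\<forall>\<^sub>F r in sequentially. (\<Sum>i\<in>F. (cmod (coord (X p) i - coord (X r) i))\<^sup>2) \<le> e\<^sup>2"
      using eventually_ge_at_top[of M]
    proof eventually_elim
      case (elim r)
      have "(\<Sum>i\<in>F. (cmod (coord (X p) i - coord (X r) i))\<^sup>2) \<le> (norm (X p - X r))\<^sup>2"
        using sum_coord_le_norm[OF that(1), of "X p - X r"] by (simp add: minus_ell2.rep_eq)
      also have "\<dots> \<le> e\<^sup>2"
        using that(2)[OF elim] by (intro power_mono) (auto simp: dist_norm)
      finally show ?case .
    qed
  qed auto
  have summ: "(\<lambda>i. (cmod (coord (X p) i - f i))\<^sup>2) summable_on UNIV"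
    if "\<And>r. r \<ge> M \<Longrightarrow> dist (X p) (X r) < e" for p M e
    using bound[OF _ that] by (intro nonneg_bdd_above_summable_on bdd_aboveI[of _ "e\<^sup>2"]) auto
  obtain M where M: "\<And>p r. p \<ge> M \<Longrightarrow> r \<ge> M \<Longrightarrow> dist (X p) (X r) < 1"
    using metric_CauchyD[OF X, of 1] by auto
  have "(\<lambda>i. (cmod (f i))\<^sup>2) summable_on UNIV"
  proof -
    have "(\<lambda>i. (cmod (coord (X M) i - f i))\<^sup>2) summable_on UNIV"
      using M[of M] by (intro summ[of M M 1]) auto
    from square_summable_add[OF coord_square_summable[of "X M"], of "\<lambda>i. - (coord (X M) i - f i)"] this
    show ?thesis by (simp add: norm_minus_commute)
  qed
  then have cf: "coord (Abs_ell2 f) = f" by (simp add: Abs_ell2_inverse)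
  have "X \<longlonglongrightarrow> Abs_ell2 f"
  proof (rule metric_LIMSEQ_I)
    fix e :: real assume "e > 0"
    then obtain M where M: "\<And>p r. p \<ge> M \<Longrightarrow> r \<ge> M \<Longrightarrow> dist (X p) (X r) < e / 2"
      using metric_CauchyD[OF X, of "e / 2"] by auto
    have "dist (X p) (Abs_ell2 f) < e" if "p \<ge> M" for p
    proof -
      have "(norm (X p - Abs_ell2 f))\<^sup>2 \<le> (e / 2)\<^sup>2"
        unfolding norm_ell2_square minus_ell2.rep_eq cf
        using M[OF that] by (intro infsum_le_finite_sums summ[of M p "e/2"] bound[of _ M p "e/2"]) auto
      then have "norm (X p - Abs_ell2 f) \<le> e / 2"
        using \<open>e > 0\<close> by (auto intro: power2_le_imp_le)
      then show ?thesis using \<open>e > 0\<close> by (simp add: dist_norm)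
    qed
    then show "\<exists>N. \<forall>p\<ge>N. dist (X p) (Abs_ell2 f) < e" by blast
  qed
  then show "convergent X" by (auto simp: convergent_def)
qed

definition basis_vec :: "'i \<Rightarrow> 'i ell2" where
  "basis_vec i = Abs_ell2 (\<lambda>j. if j = i then 1 else 0)"

lemma finite_support_square_summable:
  fixes f :: "'i \<Rightarrow> complex"
  assumes "finite F" "\<And>i. i \<notin> F \<Longrightarrow> f i = 0"
  shows "(\<lambda>i. (cmod (f i))\<^sup>2) summable_on UNIV"
  using summable_on_cong_neutral[of UNIV F "\<lambda>i. (cmod (f i))\<^sup>2" "\<lambda>i. (cmod (f i))\<^sup>2"] assms
  by (auto simp: summable_on_finite)

lemma coord_basis_vec: "coord (basis_vec i) = (\<lambda>j. if j = i then 1 else 0)"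
  unfolding basis_vec_def
  by (intro Abs_ell2_inverse CollectI finite_support_square_summable[of "{i}"]) auto

lemma cinner_basis_vec: "cinner (basis_vec i) x = coord x i"
proof -
  have "cinner (basis_vec i) x = (\<Sum>\<^sub>\<infinity>j\<in>{i}. coord x i)"
    unfolding cinner_def by (rule infsum_cong_neutral) (auto simp: coord_basis_vec)
  then show ?thesis by simp
qed

text \<open>Separability, which Bochner integration in the library requires.\<close>

instance ell2 :: (countable) second_countable_topology
proof
  define Q where "Q = {z :: complex. Re z \<in> \<rat> \<and> Im z \<in> \<rat>}"
  define lst where "lst = (\<lambda>(l :: ('a \<times> complex) list). \<Sum>(i, z)\<leftarrow>l. scaleC z (basis_vec i))"
  define D where "D = lst ` lists (UNIV \<times> Q)"
  have "Q \<subseteq> (\<lambda>(a, b). Complex a b) ` (\<rat> \<times> \<rat>)" unfolding Q_def by (force simp: image_iff complex_eq_iff)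
  then have "countable Q" by (rule countable_subset) (intro countable_image countable_SIGMA countable_rat)
  then have D: "countable D" unfolding D_def by (intro countable_image countable_lists countable_SIGMA) auto
  have Qdense: "\<exists>q\<in>Q. cmod (z - q) < e" if "e > 0" for z and e :: real
  proof -
    obtain a where a: "a \<in> \<rat>" "Re z - e / 2 < a" "a < Re z"
      using Rats_dense_in_real[of "Re z - e / 2" "Re z"] \<open>e > 0\<close> by auto
    obtain b where b: "b \<in> \<rat>" "Im z - e / 2 < b" "b < Im z"
      using Rats_dense_in_real[of "Im z - e / 2" "Im z"] \<open>e > 0\<close> by auto
    have "cmod (z - Complex a b) \<le> \<bar>Re z - a\<bar> + \<bar>Im z - b\<bar>"
      using cmod_le[of "z - Complex a b"] by simp
    also have "\<dots> < e" using a b by auto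
    finally show ?thesis using a b by (intro bexI[of _ "Complex a b"]) (auto simp: Q_def)
  qed
  have scale_norm: "norm (scaleC c x) = cmod c * norm x" for c and x :: "'a ell2"
  proof -
    have "(norm (scaleC c x))\<^sup>2 = (cmod c * norm x)\<^sup>2"
      unfolding norm_ell2_square power_mult_distrib scaleC.rep_eq norm_mult
      by (rule infsum_cmult_right) (auto intro: coord_square_summable)
    then show ?thesis by (simp add: power2_eq_iff_nonneg)
  qed
  have scaleC_diff: "scaleC (c - d) x = scaleC c x - scaleC d x" for c d and x :: "'a ell2"
    by transfer (simp add: left_diff_distrib)
  have norm_basis: "norm (basis_vec i :: 'a ell2) = 1" for i
  proof -
    have "(norm (basis_vec i :: 'a ell2))\<^sup>2 = Re (cinner (basis_vec i) (basis_vec i))"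
      by (simp add: power2_norm_eq_inner inner_ell2_def)
    then have "(norm (basis_vec i :: 'a ell2))\<^sup>2 = 1" by (simp add: cinner_basis_vec coord_basis_vec)
    then show ?thesis by (simp add: power2_eq_1_iff) (smt (verit) norm_ge_zero)
  qed
  have coord_sum: "coord (\<Sum>j\<in>F. g j) i = (\<Sum>j\<in>F. coord (g j) i)" if "finite F" for F i and g :: "'a \<Rightarrow> 'a ell2"
    using that by (induction F) (auto simp: zero_ell2.rep_eq plus_ell2.rep_eq)
  have approx1: "\<exists>d\<in>D. norm ((\<Sum>i\<in>F. scaleC (c i) (basis_vec i)) - d) < e"
    if "finite F" "e > 0" for F c and e :: real
    using that
  proof (induction F arbitrary: e)
    case empty
    have "0 \<in> D" unfolding D_def by (intro image_eqI[of _ _ "[]"]) (auto simp: lst_def)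
    then show ?case using empty by force
  next
    case (insert i F)
    obtain d where d: "d \<in> D" "norm ((\<Sum>i\<in>F. scaleC (c i) (basis_vec i)) - d) < e / 2"
      using insert.IH[of "e / 2"] insert.prems by auto
    obtain q where q: "q \<in> Q" "cmod (c i - q) < e / 2" using Qdense[of "e / 2"] insert.prems by auto
    obtain l where l: "l \<in> lists (UNIV \<times> Q)" "d = lst l" using d unfolding D_def by auto
    have "scaleC q (basis_vec i) + d \<in> D"
      unfolding D_def l using l q by (intro image_eqI[of _ _ "(i, q) # l"]) (auto simp: lst_def)
    moreover have "norm ((\<Sum>i\<in>insert i F. scaleC (c i) (basis_vec i)) - (scaleC q (basis_vec i) + d)) < e"
    proof -
      have "(\<Sum>i\<in>insert i F. scaleC (c i) (basis_vec i)) - (scaleC q (basis_vec i) + d)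
          = scaleC (c i - q) (basis_vec i) + ((\<Sum>i\<in>F. scaleC (c i) (basis_vec i)) - d)"
        using insert.hyps by (simp add: scaleC_diff)
      also have "norm \<dots> \<le> cmod (c i - q) + norm ((\<Sum>i\<in>F. scaleC (c i) (basis_vec i)) - d)"
        by (rule order_trans[OF norm_triangle_ineq]) (simp add: scale_norm norm_basis)
      finally show ?thesis using d q by simp
    qed
    ultimately show ?case by blast
  qed
  have approx2: "\<exists>F. finite F \<and> norm (x - (\<Sum>i\<in>F. scaleC (coord x i) (basis_vec i))) < e"
    if "e > 0" for x :: "'a ell2" and e :: real
  proof -
    let ?f = "\<lambda>i. (cmod (coord x i))\<^sup>2"
    have "(sum ?f \<longlongrightarrow> infsum ?f UNIV) (finite_subsets_at_top UNIV)"
      using infsum_tendsto[OF coord_square_summable] .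
    then have "\<forall>\<^sub>F F in finite_subsets_at_top UNIV. dist (sum ?f F) (infsum ?f UNIV) < e\<^sup>2"
      using \<open>e > 0\<close> by (intro tendstoD) auto
    then obtain F where F: "finite F" "dist (sum ?f F) (infsum ?f UNIV) < e\<^sup>2"
      by (auto simp: eventually_finite_subsets_at_top)
    let ?y = "\<Sum>i\<in>F. scaleC (coord x i) (basis_vec i)"
    have y: "coord (x - ?y) i = (if i \<in> F then 0 else coord x i)" for i
      using F by (simp add: minus_ell2.rep_eq coord_sum scaleC.rep_eq coord_basis_vec if_distrib
          sum.delta cong: if_cong)
    have "(norm (x - ?y))\<^sup>2 = infsum ?f (UNIV - F)"
      unfolding norm_ell2_square by (rule infsum_cong_neutral) (auto simp: y)
    also have "\<dots> = infsum ?f UNIV - sum ?f F"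
      using F by (subst infsum_Diff) (auto intro: coord_square_summable)
    also have "\<dots> < e\<^sup>2" using F by (simp add: dist_real_def)
    finally have "norm (x - ?y) < e" using \<open>e > 0\<close> by (intro power_less_imp_less_base[of _ 2 e]) auto
    then show ?thesis using F by blast
  qed
  have dense: "\<exists>d\<in>D. dist d x < e" if e: "e > 0" for x :: "'a ell2" and e :: real
  proof -
    obtain F where F: "finite F" "norm (x - (\<Sum>i\<in>F. scaleC (coord x i) (basis_vec i))) < e / 2"
      using approx2[of "e / 2" x] e by auto
    obtain d where d: "d \<in> D" "norm ((\<Sum>i\<in>F. scaleC (coord x i) (basis_vec i)) - d) < e / 2"
      using approx1[OF F(1), of "e / 2" "coord x"] e by auto
    have "norm (x - d) \<le> norm (x - (\<Sum>i\<in>F. scaleC (coord x i) (basis_vec i)))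
        + norm ((\<Sum>i\<in>F. scaleC (coord x i) (basis_vec i)) - d)"
      using norm_triangle_ineq[of "x - (\<Sum>i\<in>F. scaleC (coord x i) (basis_vec i))"
          "(\<Sum>i\<in>F. scaleC (coord x i) (basis_vec i)) - d"] by simp
    with F d show ?thesis by (intro bexI[of _ d]) (auto simp: dist_norm norm_minus_commute)
  qed
  define B where "B = (\<lambda>(d, r). ball d r) ` (D \<times> (\<rat> \<inter> {0<..}))"
  have "countable B" unfolding B_def
    by (intro countable_image countable_SIGMA D countable_Int1 countable_rat)
  moreover have "topological_basis B"
  proof (rule topological_basisI)
    fix S assume "S \<in> B"
    then show "open S" by (auto simp: B_def)
  next
    fix S :: "'a ell2 set" and x assume S: "open S" "x \<in> S"
    then obtain e where e: "e > 0" "ball x e \<subseteq> S" by (meson open_contains_ball)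
    obtain d where d: "d \<in> D" "dist d x < e / 4" using dense[of "e / 4" x] e by auto
    obtain r where r: "r \<in> \<rat>" "e / 4 < r" "r < e / 2" using Rats_dense_in_real[of "e / 4" "e / 2"] e by auto
    have "ball d r \<subseteq> ball x e"
    proof
      fix y assume "y \<in> ball d r"
      then show "y \<in> ball x e" using d r dist_triangle[of x y d] by (auto simp: dist_commute)
    qed
    moreover have "x \<in> ball d r" "ball d r \<in> B" using d r e unfolding B_def by force+
    ultimately show "\<exists>B'\<in>B. x \<in> B' \<and> B' \<subseteq> S" using e by blast
  qed
  ultimately show "\<exists>B::'a ell2 set set. countable B \<and> open = generate_topology B"
    using topological_basis_imp_subbasis by (intro exI[of _ B] conjI) 
qed

section \<open>Von Neumann algebras of operators on \<open>\<ell>\<^sup>2\<close>\<close>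

definition bounded_op :: "('i ell2 \<Rightarrow> 'i ell2) \<Rightarrow> bool" where
  "bounded_op A \<longleftrightarrow> bounded_linear A \<and> (\<forall>c x. A (scaleC c x) = scaleC c (A x))"

definition is_adjoint :: "('i ell2 \<Rightarrow> 'i ell2) \<Rightarrow> ('i ell2 \<Rightarrow> 'i ell2) \<Rightarrow> bool" where
  "is_adjoint A B \<longleftrightarrow> (\<forall>x y. cinner (A x) y = cinner x (B y))"

definition commutant :: "('i ell2 \<Rightarrow> 'i ell2) set \<Rightarrow> ('i ell2 \<Rightarrow> 'i ell2) set" where
  "commutant S = {A. bounded_op A \<and> (\<forall>B\<in>S. A \<circ> B = B \<circ> A)}"

definition vN_generated :: "('i ell2 \<Rightarrow> 'i ell2) set \<Rightarrow> ('i ell2 \<Rightarrow> 'i ell2) set" where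
  "vN_generated S = commutant (commutant (S \<union> {B. bounded_op B \<and> (\<exists>A\<in>S. is_adjoint A B)}))"

section \<open>The noncommutative torus\<close>

text \<open>The indices \<open>1, \<dots>, n\<close> are the elements of a finite linearly ordered type \<open>'n\<close>.\<close>

type_synonym 'n freq = "(int, 'n) vec"
type_synonym 'n torus_matrix = "((real, 'n) vec, 'n) vec"
type_synonym 'n torus_L2 = "'n freq ell2"

definition torus_phase :: "('n::{finite,linorder}) torus_matrix \<Rightarrow> 'n \<Rightarrow> 'n freq \<Rightarrow> complex" where
  "torus_phase \<theta> j m = cis (2 * pi * (\<Sum>l | l < j. \<theta> $ j $ l * of_int (m $ l)))"

text \<open>The unitary \<open>U\<^sub>j\<close>; the form on the canonical basis is \<open>torus_U_basis_vec\<close> below.\<close>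

lift_definition torus_U ::
    "('n::{finite,linorder}) torus_matrix \<Rightarrow> 'n \<Rightarrow> 'n torus_L2 \<Rightarrow> 'n torus_L2"
  is "\<lambda>\<theta> j f m. torus_phase \<theta> j (m - axis j 1) * f (m - axis j 1)"
proof -
  fix \<theta> :: "'n torus_matrix" and j :: 'n and f :: "'n freq \<Rightarrow> complex"
  assume f: "(\<lambda>i. (cmod (f i))\<^sup>2) summable_on UNIV"
  have "bij_betw (\<lambda>m::'n freq. m - axis j 1) UNIV UNIV"
    by (rule bij_betw_byWitness[of _ "\<lambda>m. m + axis j 1"]) auto
  from summable_on_reindex_bij_betw[OF this, of "\<lambda>i. (cmod (f i))\<^sup>2"] f
  show "(\<lambda>m. (cmod (torus_phase \<theta> j (m - axis j 1) * f (m - axis j 1)))\<^sup>2) summable_on UNIV"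
    by (simp add: norm_mult torus_phase_def)
qed

definition iter_int :: "('a \<Rightarrow> 'a) \<Rightarrow> int \<Rightarrow> 'a \<Rightarrow> 'a" where
  "iter_int A p = (if p \<ge> 0 then A ^^ nat p else inv A ^^ nat (- p))"

text \<open>\<open>U\<^sup>m = U\<^sub>1\<^bsup>m\<^sub>1\<^esup> \<cdots> U\<^sub>n\<^bsup>m\<^sub>n\<^esup>\<close>\<close>

definition torus_monomial ::
    "('n::{finite,linorder}) torus_matrix \<Rightarrow> 'n freq \<Rightarrow> 'n torus_L2 \<Rightarrow> 'n torus_L2" where
  "torus_monomial \<theta> m =
     foldr (\<lambda>j A. iter_int (torus_U \<theta> j) (m $ j) \<circ> A) (sorted_list_of_set UNIV) id"

definition torus_Linf ::
    "('n::{finite,linorder}) torus_matrix \<Rightarrow> ('n torus_L2 \<Rightarrow> 'n torus_L2) set" where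
  "torus_Linf \<theta> = vN_generated (range (torus_U \<theta>))"

text \<open>
  The canonical trace is the vector state \<open>\<tau>(x) = \<langle>e\<^sub>0, x e\<^sub>0\<rangle>\<close>, so that
  \<open>\<parallel>x\<parallel>\<^bsub>L\<^sup>2\<^esub> = \<parallel>x e\<^sub>0\<parallel>\<close> and \<open>x \<mapsto> x e\<^sub>0\<close> is an isometry of the smooth algebra onto a dense subspace of
  \<open>\<ell>\<^sup>2(\<int>\<^sup>n)\<close> (it maps \<open>U\<^sup>m\<close> to \<open>e\<^sub>m\<close>, see \<open>torus_monomial_basis_vec\<close>). This realizes the completion
  \<open>L\<^sup>2\<close> as \<open>\<ell>\<^sup>2(\<int>\<^sup>n)\<close>; an element \<open>x\<close> of \<open>torus_Linf\<close> is identified with \<open>x e\<^sub>0\<close>, and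
  \<open>\<tau>((U\<^sup>m)\<^sup>* a) = \<langle>U\<^sup>m e\<^sub>0, a e\<^sub>0\<rangle>\<close>.
\<close>

definition torus_trace :: "(('n::finite) torus_L2 \<Rightarrow> 'n torus_L2) \<Rightarrow> complex" where
  "torus_trace x = cinner (basis_vec 0) (x (basis_vec 0))"

definition fourier :: "('n::{finite,linorder}) torus_matrix \<Rightarrow> 'n torus_L2 \<Rightarrow> 'n freq \<Rightarrow> complex" where
  "fourier \<theta> a m = cinner (torus_monomial \<theta> m (basis_vec 0)) a"

lemma fourier_trace:
  assumes "is_adjoint (torus_monomial \<theta> m) B"
  shows "fourier \<theta> (x (basis_vec 0)) m = torus_trace (B \<circ> x)"
  using assms by (simp add: is_adjoint_def fourier_def torus_trace_def)

lemma torus_U_basis_vec: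
  "torus_U \<theta> j (basis_vec m) = scaleC (torus_phase \<theta> j m) (basis_vec (m + axis j 1))"
  unfolding coord_inject[symmetric] torus_U.rep_eq scaleC.rep_eq coord_basis_vec
  by (auto simp: fun_eq_iff algebra_simps)

lemma inj_torus_U: "inj (torus_U \<theta> j)"
proof (rule injI)
  fix x y assume "torus_U \<theta> j x = torus_U \<theta> j y"
  then have *: "coord (torus_U \<theta> j x) m = coord (torus_U \<theta> j y) m" for m by simp
  have "coord x m = coord y m" for m
    using *[of "m + axis j 1"] by (simp add: torus_U.rep_eq torus_phase_def)
  then show "x = y" by (simp add: coord_inject[symmetric] fun_eq_iff)
qed

lemma torus_U_basis_vec_low:
  assumes "\<And>l. l < j \<Longrightarrow> m $ l = 0"
  shows "torus_U \<theta> j (basis_vec m) = basis_vec (m + axis j 1)"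
proof -
  have "torus_phase \<theta> j m = 1" using assms by (simp add: torus_phase_def)
  then show ?thesis
    unfolding torus_U_basis_vec by (simp add: coord_inject[symmetric] scaleC.rep_eq)
qed

lemma iter_int_torus_U_basis_vec:
  fixes m :: "('n::{finite,linorder}) freq"
  assumes "\<And>l. l < j \<Longrightarrow> m $ l = 0"
  shows "iter_int (torus_U \<theta> j) p (basis_vec m) = basis_vec (m + axis j p)"
proof -
  have low: "(m + axis j q) $ l = 0" if "l < j" for l q
    using assms[OF that] that by (simp add: axis_def)
  have ax: "axis j (q + 1) = axis j q + (axis j 1 :: 'n freq)" for q :: int
    by (simp add: vec_eq_iff axis_def)
  have step: "torus_U \<theta> j (basis_vec (m + axis j q)) = basis_vec (m + axis j (q + 1))" for q
    using torus_U_basis_vec_low[of j "m + axis j q" \<theta>, OF low] by (simp add: ax add.assoc)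
  have ax0: "axis j 0 = (0 :: 'n freq)" by (simp add: vec_eq_iff axis_def)
  have pos: "(torus_U \<theta> j ^^ r) (basis_vec m) = basis_vec (m + axis j (int r))" for r
    by (induction r) (simp_all add: ax0 step add.commute)
  have inv_step: "inv (torus_U \<theta> j) (basis_vec (m + axis j q)) = basis_vec (m + axis j (q - 1))" for q
    using inv_f_f[OF inj_torus_U, of \<theta> j "basis_vec (m + axis j (q - 1))"] step[of "q - 1"] by simp
  have neg: "(inv (torus_U \<theta> j) ^^ r) (basis_vec m) = basis_vec (m + axis j (- int r))" for r
    by (induction r) (simp_all add: ax0 inv_step minus_diff_commute)
  show ?thesis
    using pos[of "nat p"] neg[of "nat (- p)"] by (auto simp: iter_int_def)
qed

lemma torus_monomial_basis_vec: "torus_monomial \<theta> m (basis_vec 0) = basis_vec m"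
proof -
  have "foldr (\<lambda>j A. iter_int (torus_U \<theta> j) (m $ j) \<circ> A) l id (basis_vec 0)
      = basis_vec (\<chi> i. if i \<in> set l then m $ i else 0)"
    if "sorted_wrt (<) l" for l
    using that
  proof (induction l)
    case Nil
    then show ?case by (simp add: zero_vec_def)
  next
    case (Cons j l)
    have "(\<chi> i. if i \<in> set l then m $ i else 0) + axis j (m $ j)
        = (\<chi> i. if i \<in> set (j # l) then m $ i else 0)"
      using Cons.prems by (auto simp: vec_eq_iff axis_def)
    moreover have "iter_int (torus_U \<theta> j) (m $ j) (basis_vec (\<chi> i. if i \<in> set l then m $ i else 0))
        = basis_vec ((\<chi> i. if i \<in> set l then m $ i else 0) + axis j (m $ j))"
      by (rule iter_int_torus_U_basis_vec) (use Cons.prems in \<open>auto dest: less_trans\<close>)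
    ultimately show ?case using Cons by simp
  qed
  from this[of "sorted_list_of_set UNIV"] show ?thesis
    by (simp add: torus_monomial_def strict_sorted_list_of_set)
qed

lemma fourier_eq_coord: "fourier \<theta> a m = coord a m"
  by (simp add: fourier_def torus_monomial_basis_vec cinner_basis_vec)

section \<open>Sobolev spaces\<close>

definition freq_sq :: "('n::finite) freq \<Rightarrow> real" where
  "freq_sq m = (\<Sum>i\<in>UNIV. (of_int (m $ i))\<^sup>2)"

definition sobolev :: "('n::{finite,linorder}) torus_matrix \<Rightarrow> real \<Rightarrow> 'n torus_L2 set" where
  "sobolev \<theta> s =
     {a. (\<lambda>m. (1 + 4 * pi\<^sup>2 * freq_sq m) powr s * (cmod (fourier \<theta> a m))\<^sup>2) summable_on UNIV}"

definition sobolev_norm :: "('n::{finite,linorder}) torus_matrix \<Rightarrow> real \<Rightarrow> 'n torus_L2 \<Rightarrow> real" where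
  "sobolev_norm \<theta> s a =
     sqrt (\<Sum>\<^sub>\<infinity>m. (1 + 4 * pi\<^sup>2 * freq_sq m) powr s * (cmod (fourier \<theta> a m))\<^sup>2)"

definition sobolev_continuous_on ::
    "('n::{finite,linorder}) torus_matrix \<Rightarrow> real \<Rightarrow> real set \<Rightarrow> (real \<Rightarrow> 'n torus_L2) \<Rightarrow> bool" where
  "sobolev_continuous_on \<theta> s I u \<longleftrightarrow>
     (\<forall>t\<in>I. u t \<in> sobolev \<theta> s) \<and>
     (\<forall>t\<in>I. ((\<lambda>r. sobolev_norm \<theta> s (u r - u t)) \<longlongrightarrow> 0) (at t within I))"

text \<open>
  The Fourier multiplier with symbol \<open>g\<close>; meaningful only where the sequence \<open>g m * fourier \<theta> a m\<close>
  is square-summable.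
\<close>

definition fourier_mult ::
    "('n::{finite,linorder}) torus_matrix \<Rightarrow> ('n freq \<Rightarrow> real) \<Rightarrow> 'n torus_L2 \<Rightarrow> 'n torus_L2" where
  "fourier_mult \<theta> g a = (THE b. \<forall>m. fourier \<theta> b m = of_real (g m) * fourier \<theta> a m)"

lemma fourier_fourier_mult:
  assumes "(\<lambda>m. (cmod (of_real (g m) * fourier \<theta> a m))\<^sup>2) summable_on UNIV"
  shows "fourier \<theta> (fourier_mult \<theta> g a) m = of_real (g m) * fourier \<theta> a m"
proof -
  define b where "b = Abs_ell2 (\<lambda>m. of_real (g m) * fourier \<theta> a m)"
  have "coord b = (\<lambda>m. of_real (g m) * fourier \<theta> a m)"
    unfolding b_def using assms by (intro Abs_ell2_inverse) simp
  then have b: "\<forall>m. fourier \<theta> b m = of_real (g m) * fourier \<theta> a m"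
    by (simp add: fourier_eq_coord)
  have "fourier_mult \<theta> g a = b"
    unfolding fourier_mult_def
    by (rule the_equality) (use b in \<open>auto simp: fourier_eq_coord coord_inject[symmetric] fun_eq_iff\<close>)
  then show ?thesis using b by simp
qed

text \<open>\<open>H\<^sup>s \<rightarrow> L\<^sup>2\<close>, the isometric isomorphism \<open>(1 + L)\<^bsup>s/2\<^esup>\<close>\<close>

definition sobolev_iso ::
    "('n::{finite,linorder}) torus_matrix \<Rightarrow> real \<Rightarrow> 'n torus_L2 \<Rightarrow> 'n torus_L2" where
  "sobolev_iso \<theta> s = fourier_mult \<theta> (\<lambda>m. (1 + 4 * pi\<^sup>2 * freq_sq m) powr (s / 2))"

lemma norm_sobolev_iso:
  assumes "a \<in> sobolev \<theta> s"
  shows "norm (sobolev_iso \<theta> s a) = sobolev_norm \<theta> s a"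
proof -
  have "freq_sq m \<ge> 0" for m :: "'a freq" by (simp add: freq_sq_def sum_nonneg)
  then have pos: "1 + 4 * pi\<^sup>2 * freq_sq m > 0" for m :: "'a freq"
    by (intro add_pos_nonneg) auto
  have sq: "(cmod (of_real ((1 + 4 * pi\<^sup>2 * freq_sq m) powr (s / 2)) * fourier \<theta> a m))\<^sup>2
      = (1 + 4 * pi\<^sup>2 * freq_sq m) powr s * (cmod (fourier \<theta> a m))\<^sup>2" for m
  proof -
    have "((1 + 4 * pi\<^sup>2 * freq_sq m) powr (s / 2))\<^sup>2 = (1 + 4 * pi\<^sup>2 * freq_sq m) powr s"
      by (simp add: power2_eq_square powr_add[symmetric])
    then show ?thesis by (simp add: norm_mult power_mult_distrib)
  qed
  have coord_iso: "coord (sobolev_iso \<theta> s a) m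
      = of_real ((1 + 4 * pi\<^sup>2 * freq_sq m) powr (s / 2)) * fourier \<theta> a m" for m
    unfolding sobolev_iso_def fourier_eq_coord[of \<theta>, symmetric]
    by (rule fourier_fourier_mult) (use assms in \<open>simp only: sq sobolev_def mem_Collect_eq\<close>)
  have "(norm (sobolev_iso \<theta> s a))\<^sup>2
      = (\<Sum>\<^sub>\<infinity>m. (1 + 4 * pi\<^sup>2 * freq_sq m) powr s * (cmod (fourier \<theta> a m))\<^sup>2)"
    unfolding norm_ell2_square coord_iso sq ..
  then show ?thesis
    unfolding sobolev_norm_def by (metis norm_ge_zero real_sqrt_unique)
qed

text \<open>
  The Bochner integral in the Banach space \<open>H\<^sup>s\<close>. As \<open>s\<close> is a term, \<open>H\<^sup>s\<close> is not a type, and the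
  library integral is transported along \<open>sobolev_iso\<close>.
\<close>

definition has_sobolev_integral ::
    "('n::{finite,linorder}) torus_matrix \<Rightarrow> real \<Rightarrow> real set \<Rightarrow> (real \<Rightarrow> 'n torus_L2) \<Rightarrow>
      'n torus_L2 \<Rightarrow> bool" where
  "has_sobolev_integral \<theta> s I f x \<longleftrightarrow>
     (\<forall>r\<in>I. f r \<in> sobolev \<theta> s) \<and> x \<in> sobolev \<theta> s \<and>
     has_bochner_integral (lebesgue_on I) (\<lambda>r. sobolev_iso \<theta> s (f r)) (sobolev_iso \<theta> s x)"

definition heat ::
    "('n::{finite,linorder}) torus_matrix \<Rightarrow> real \<Rightarrow> 'n torus_L2 \<Rightarrow> 'n torus_L2" where
  "heat \<theta> t = fourier_mult \<theta> (\<lambda>m. exp (- 4 * pi\<^sup>2 * freq_sq m * t))"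

section \<open>Products and noncommutative polynomials\<close>

text \<open>
  The operator in \<open>L\<^sup>\<infinity>\<close> corresponding to an element of \<open>L\<^sup>\<infinity> \<subseteq> L\<^sup>2\<close>; it is unique because \<open>e\<^sub>0\<close> is
  separating. The value is unspecified on vectors outside \<open>L\<^sup>\<infinity>\<close>.
\<close>

definition torus_op ::
    "('n::{finite,linorder}) torus_matrix \<Rightarrow> 'n torus_L2 \<Rightarrow> 'n torus_L2 \<Rightarrow> 'n torus_L2" where
  "torus_op \<theta> a = (THE x. x \<in> torus_Linf \<theta> \<and> x (basis_vec 0) = a)"

definition torus_times ::
    "('n::{finite,linorder}) torus_matrix \<Rightarrow> 'n torus_L2 \<Rightarrow> 'n torus_L2 \<Rightarrow> 'n torus_L2" where
  "torus_times \<theta> a b = (torus_op \<theta> a \<circ> torus_op \<theta> b) (basis_vec 0)"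

text \<open>\<open>b\<^sub>0 u b\<^sub>1 u \<cdots> u b\<^sub>\<nu>\<close>\<close>

primrec nc_monomial ::
    "('n::{finite,linorder}) torus_matrix \<Rightarrow> (nat \<Rightarrow> 'n torus_L2) \<Rightarrow> nat \<Rightarrow> 'n torus_L2 \<Rightarrow>
      'n torus_L2" where
  "nc_monomial \<theta> b 0 u = b 0"
| "nc_monomial \<theta> b (Suc \<nu>) u =
     torus_times \<theta> (torus_times \<theta> (nc_monomial \<theta> b \<nu> u) u) (b (Suc \<nu>))"

definition nc_polynomial ::
    "('n::{finite,linorder}) torus_matrix \<Rightarrow> nat \<Rightarrow> (nat \<Rightarrow> nat) \<Rightarrow> (nat \<Rightarrow> nat \<Rightarrow> nat \<Rightarrow> 'n torus_L2) \<Rightarrow>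
      'n torus_L2 \<Rightarrow> 'n torus_L2" where
  "nc_polynomial \<theta> q N b u = (\<Sum>\<nu>=0..q. \<Sum>\<mu>=1..N \<nu>. nc_monomial \<theta> (b \<nu> \<mu>) \<nu> u)"

section \<open>Mild solutions\<close>

definition mild_solution ::
    "('n::{finite,linorder}) torus_matrix \<Rightarrow> real \<Rightarrow> ('n torus_L2 \<Rightarrow> 'n torus_L2) \<Rightarrow>
      'n torus_L2 \<Rightarrow> real \<Rightarrow> (real \<Rightarrow> 'n torus_L2) \<Rightarrow> bool" where
  "mild_solution \<theta> s P u0 T u \<longleftrightarrow>
     sobolev_continuous_on \<theta> s {0..T} u \<and>
     (\<forall>t\<in>{0..T}. \<exists>x. has_sobolev_integral \<theta> s {0..t} (\<lambda>r. heat \<theta> (t - r) (P (u r))) x \<and>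
        u t = heat \<theta> t u0 + x)"

definition max_existence_time ::
    "('n::{finite,linorder}) torus_matrix \<Rightarrow> real \<Rightarrow> ('n torus_L2 \<Rightarrow> 'n torus_L2) \<Rightarrow>
      'n torus_L2 \<Rightarrow> ereal" where
  "max_existence_time \<theta> s P u0 = Sup {ereal T | T. T > 0 \<and> (\<exists>u. mild_solution \<theta> s P u0 T u)}"

end

theory Submission
  imports Defs
begin

text \<open>
  For \<open>k > n/2\<close> elements of \<open>H\<^sup>k\<close> have absolutely summable Fourier coefficients, so their product is a
  twisted convolution and \<open>H\<^sup>s\<close> is an algebra for every \<open>s \<ge> k\<close>. Hence, if the solution is bounded in
  \<open>H\<^sup>s\<close> on \<open>[\<epsilon>, T]\<close>, so is the nonlinearity. Coefficientwise, Duhamel's formula restarted at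
  \<open>\<epsilon>\<close> and the Cauchy-Schwarz inequality in time then bound the solution in \<open>H\<^bsup>s+1\<^esup>\<close> on
  \<open>[\<epsilon> + \<delta>, T]\<close>, and by iteration in every \<open>H\<^bsup>k+r\<^esup>\<close>. Continuity in \<open>H\<^bsup>k+r\<^esup>\<close> follows by
  interpolating between continuity in \<open>H\<^sup>k\<close> and boundedness in \<open>H\<^bsup>k+2r\<^esup>\<close>.
\<close>

section \<open>Bounded operators on \<open>\<ell>\<^sup>2\<close>\<close>

text \<open>Products are defined by a definite description inside a double commutant, so the
  operator belonging to an element of H^k has to be exhibited before anything can be estimated;
  absolute summability is what makes the series of shifts converge in norm. The time estimates treat
  one Fourier coefficient at a time because nothing is known beforehand about continuity or
  measurability of the solution in a higher Sobolev norm. A coordinate is a bounded functional, so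
  the Bochner integral becomes a scalar integral with kernel e^{-l(t-r)}, where l = 4 pi^2 |m|^2,
  and weighted finite sums over m commute with it. The iteration therefore carries only a bound
  valid at every time. One round gains one derivative because the square of the kernel has integral
  at most (t - \<epsilon> + 1)/(1 + l). The restart is forced by the initial datum, which is only in
  H^k: the term e^{-l(t-\<epsilon>)} u(\<epsilon>) gains a derivative at the price of a factor of
  order 1/\<delta>, so each round gives up a piece of the time interval.\<close>

lemma ell2_eqI: "(\<And>i. coord x i = coord y i) \<Longrightarrow> x = y"
  by (simp add: coord_inject[symmetric] fun_eq_iff)

lemma bounded_linear_coord: "bounded_linear (\<lambda>x. coord x i)"
  by (rule bounded_linear_intro[of _ 1])
    (auto simp: plus_ell2.rep_eq scaleR_ell2.rep_eq scaleR_conv_of_real coord_le_norm)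

lemma norm_scaleC: "norm (scaleC c x) = cmod c * norm x"
proof -
  have "(norm (scaleC c x))\<^sup>2 = (cmod c * norm x)\<^sup>2"
    unfolding norm_ell2_square power_mult_distrib scaleC.rep_eq norm_mult
    by (rule infsum_cmult_right) (auto intro: coord_square_summable)
  then show ?thesis by (simp add: power2_eq_iff_nonneg)
qed

lemma bounded_op_scaleC: "bounded_op (scaleC c)"
  unfolding bounded_op_def
proof (intro conjI allI)
  show "bounded_linear (scaleC c)"
    by (rule bounded_linear_intro[of _ "cmod c"])
      (auto simp: norm_scaleC mult.commute plus_ell2.rep_eq scaleR_ell2.rep_eq scaleC.rep_eq
        algebra_simps intro!: ell2_eqI)
qed (auto simp: scaleC.rep_eq algebra_simps intro!: ell2_eqI)

lemma coord_sum: "coord (\<Sum>j\<in>F. g j) i = (\<Sum>j\<in>F. coord (g j) i)"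
  by (induction F rule: infinite_finite_induct) (auto simp: zero_ell2.rep_eq plus_ell2.rep_eq)

text \<open>The squared error of a finite partial sum is the remaining part of the series of
  squares, so the expansion converges in norm and bounded operators may be applied term by
  term.\<close>

lemma has_sum_basis_vec: "((\<lambda>i. scaleC (coord x i) (basis_vec i)) has_sum x) UNIV"
proof -
  let ?f = "\<lambda>i. (cmod (coord x i))\<^sup>2"
  have sq: "(norm (sum (\<lambda>i. scaleC (coord x i) (basis_vec i)) F - x))\<^sup>2 = infsum ?f UNIV - sum ?f F"
    if F: "finite F" for F
  proof -
    let ?y = "\<Sum>i\<in>F. scaleC (coord x i) (basis_vec i)"
    have y: "coord (?y - x) i = (if i \<in> F then 0 else - coord x i)" for i
      using F by (simp add: minus_ell2.rep_eq coord_sum scaleC.rep_eq coord_basis_vec if_distrib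
          sum.delta cong: if_cong)
    have "(norm (?y - x))\<^sup>2 = infsum ?f (UNIV - F)"
      unfolding norm_ell2_square by (rule infsum_cong_neutral) (auto simp: y)
    also have "\<dots> = infsum ?f UNIV - sum ?f F"
      using F by (subst infsum_Diff) (auto intro: coord_square_summable)
    finally show ?thesis .
  qed
  have "((\<lambda>F. infsum ?f UNIV - sum ?f F) \<longlongrightarrow> 0) (finite_subsets_at_top UNIV)"
    using tendsto_diff[OF tendsto_const[of "infsum ?f UNIV"] infsum_tendsto[OF coord_square_summable[of x]]] by simp
  then have "((\<lambda>F. (norm (sum (\<lambda>i. scaleC (coord x i) (basis_vec i)) F - x))\<^sup>2) \<longlongrightarrow> 0)
      (finite_subsets_at_top UNIV)"
    by (rule Lim_transform_eventually)
      (auto simp: sq eventually_finite_subsets_at_top intro!: exI[of _ "{}"])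
  from tendsto_real_sqrt[OF this] have "((\<lambda>F. norm (sum (\<lambda>i. scaleC (coord x i) (basis_vec i)) F - x)) \<longlongrightarrow> 0)
      (finite_subsets_at_top UNIV)" by simp
  then show ?thesis
    unfolding has_sum_def by (rule Lim_null[THEN iffD2, OF tendsto_norm_zero_cancel])
qed

lemma bounded_op_eqI:
  assumes "bounded_op A" "bounded_op B" "\<And>i. A (basis_vec i) = B (basis_vec i)"
  shows "A = B"
proof
  fix x
  have lin: "bounded_linear A" "bounded_linear B"
    using assms(1,2) by (simp_all add: bounded_op_def)
  have "A (scaleC c (basis_vec i)) = B (scaleC c (basis_vec i))" for c i
    using assms by (simp add: bounded_op_def)
  then have "((\<lambda>i. A (scaleC (coord x i) (basis_vec i))) has_sum B x) UNIV"
    using has_sum_bounded_linear[OF lin(2) has_sum_basis_vec[of x]] by simp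
  then show "A x = B x"
    using has_sum_bounded_linear[OF lin(1) has_sum_basis_vec[of x]] has_sum_unique by blast
qed

section \<open>Twisted shifts\<close>

lemma infsum_shift: "(\<Sum>\<^sub>\<infinity>m. f (m - p)) = (\<Sum>\<^sub>\<infinity>m. f m)"
  for p :: "'i::ab_group_add"
  by (rule infsum_reindex_bij_betw) (rule bij_betw_byWitness[of _ "\<lambda>m. m + p"]; auto)

lemma summable_on_shift: "(\<lambda>m. f (m - p)) summable_on UNIV \<longleftrightarrow> f summable_on UNIV"
  for p :: "'i::ab_group_add"
  by (rule summable_on_reindex_bij_betw) (rule bij_betw_byWitness[of _ "\<lambda>m. m + p"]; auto)

text \<open>One family contains the generators, their adjoints and the left and right
  multiplications by monomials. It is closed under composition and adjoints, so commutation
  relations become identities between phases.\<close>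

lift_definition phase_shift :: "('i::ab_group_add \<Rightarrow> real) \<Rightarrow> 'i \<Rightarrow> 'i ell2 \<Rightarrow> 'i ell2"
  is "\<lambda>\<phi> p f m. cis (\<phi> (m - p)) * f (m - p)"
  subgoal for \<phi> p f
    using summable_on_shift[of "\<lambda>i. (cmod (f i))\<^sup>2" p] by (simp add: norm_mult)
  done

lemma norm_phase_shift [simp]: "norm (phase_shift \<phi> p x) = norm x"
proof -
  have "(norm (phase_shift \<phi> p x))\<^sup>2 = (norm x)\<^sup>2"
    using infsum_shift[of "\<lambda>i. (cmod (coord x i))\<^sup>2" p]
    by (simp add: norm_ell2_square phase_shift.rep_eq norm_mult)
  then show ?thesis by (simp add: power2_eq_iff_nonneg)
qed

lemma bounded_op_phase_shift: "bounded_op (phase_shift \<phi> p)"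
  unfolding bounded_op_def
proof (intro conjI allI)
  show "bounded_linear (phase_shift \<phi> p)"
    by (rule bounded_linear_intro[of _ 1])
      (auto simp: phase_shift.rep_eq plus_ell2.rep_eq scaleR_ell2.rep_eq algebra_simps intro!: ell2_eqI)
qed (auto simp: phase_shift.rep_eq scaleC.rep_eq algebra_simps intro!: ell2_eqI)

lemma inj_phase_shift: "inj (phase_shift \<phi> p)"
proof (rule injI)
  fix x y assume "phase_shift \<phi> p x = phase_shift \<phi> p y"
  then have "phase_shift \<phi> p (x - y) = 0"
    using bounded_op_phase_shift[of \<phi> p] by (simp add: bounded_op_def bounded_linear.linear linear_diff)
  then have "norm (x - y) = 0" by (metis norm_phase_shift norm_zero)
  then show "x = y" by simp
qed

lemma phase_shift_phase_shift:
  "phase_shift \<phi> p (phase_shift \<psi> q x) = phase_shift (\<lambda>m. \<phi> (m + q) + \<psi> m) (p + q) x"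
proof (rule ell2_eqI)
  fix m
  have "m - (p + q) + q = m - p" "m - p - q = m - (p + q)" by (simp_all add: algebra_simps)
  then show "coord (phase_shift \<phi> p (phase_shift \<psi> q x)) m
      = coord (phase_shift (\<lambda>m. \<phi> (m + q) + \<psi> m) (p + q) x) m"
    by (simp only: phase_shift.rep_eq cis_mult[symmetric] mult.assoc)
qed

lemma phase_shift_basis_vec: "phase_shift \<phi> p (basis_vec m) = scaleC (cis (\<phi> m)) (basis_vec (m + p))"
  by (rule ell2_eqI) (auto simp: phase_shift.rep_eq scaleC.rep_eq coord_basis_vec algebra_simps)

lemma scaleC_cis_phase_shift:
  "scaleC (cis c) (phase_shift \<phi> p x) = phase_shift (\<lambda>m. c + \<phi> m) p x"
  by (rule ell2_eqI) (simp add: phase_shift.rep_eq scaleC.rep_eq cis_mult[symmetric] mult.assoc)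

lemma cinner_basis_vec_left: "cinner (scaleC c (basis_vec i)) x = cnj c * coord x i"
proof -
  have "cinner (scaleC c (basis_vec i)) x = (\<Sum>\<^sub>\<infinity>j\<in>{i}. cnj c * coord x i)"
    unfolding cinner_def by (rule infsum_cong_neutral) (auto simp: coord_basis_vec scaleC.rep_eq)
  then show ?thesis by simp
qed

text \<open>Pairing with basis vectors determines an adjoint completely. This identifies the
  adjoints that \<open>vN_generated\<close> adds to the generators.\<close>

lemma adjoint_phase_shift:
  assumes "is_adjoint (phase_shift \<phi> p) B"
  shows "B = phase_shift (\<lambda>m. - \<phi> (m - p)) (- p)"
proof (intro ext ell2_eqI)
  fix y m
  have "coord (B y) m = cinner (phase_shift \<phi> p (basis_vec m)) y"
    using assms by (simp add: is_adjoint_def cinner_basis_vec)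
  then show "coord (B y) m = coord (phase_shift (\<lambda>m. - \<phi> (m - p)) (- p) y) m"
    by (simp add: phase_shift_basis_vec cinner_basis_vec_left phase_shift.rep_eq cis_cnj)
qed

text \<open>The exponent of the cocycle of the torus: \<open>U^p U^m\<close> is
  \<open>cis (twist \<theta> p m)\<close> times \<open>U^(p+m)\<close> for the ordered monomials. It
  is additive in each argument, which is all that the phase computations use.\<close>

definition twist :: "('n::{finite,linorder}) torus_matrix \<Rightarrow> 'n freq \<Rightarrow> 'n freq \<Rightarrow> real" where
  "twist \<theta> p m = 2 * pi * (\<Sum>j\<in>UNIV. \<Sum>l | l < j. \<theta> $ j $ l * of_int (p $ j) * of_int (m $ l))"

lemma twist_add_left: "twist \<theta> (p + q) m = twist \<theta> p m + twist \<theta> q m"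
  by (simp add: twist_def sum.distrib algebra_simps)

lemma twist_add_right: "twist \<theta> p (m + q) = twist \<theta> p m + twist \<theta> p q"
  by (simp add: twist_def sum.distrib algebra_simps)

lemma twist_0 [simp]: "twist \<theta> 0 m = 0" "twist \<theta> p 0 = 0"
  by (simp_all add: twist_def)

lemma twist_minus [simp]: "twist \<theta> (- p) m = - twist \<theta> p m" "twist \<theta> p (- m) = - twist \<theta> p m"
  by (simp_all add: twist_def sum_negf)

lemma twist_diff_left: "twist \<theta> (p - q) m = twist \<theta> p m - twist \<theta> q m"
  using twist_add_left[of \<theta> p "- q"] by simp

lemma twist_diff_right: "twist \<theta> p (m - q) = twist \<theta> p m - twist \<theta> p q"
  using twist_add_right[of \<theta> p m "- q"] by simp

text \<open>Under the identification of \<open>U^m\<close> with \<open>basis_vec m\<close> these are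
  left multiplication by \<open>U^p\<close> and right multiplication by \<open>U^q\<close>.\<close>

abbreviation left_shift where "left_shift \<theta> p \<equiv> phase_shift (twist \<theta> p) p"
abbreviation right_shift where "right_shift \<theta> q \<equiv> phase_shift (\<lambda>m. twist \<theta> m q) q"

lemma torus_U_eq_left_shift: "torus_U \<theta> j = left_shift \<theta> (axis j 1)"
proof (intro ext ell2_eqI)
  fix x m
  have "twist \<theta> (axis j 1) p = 2 * pi * (\<Sum>l | l < j. \<theta> $ j $ l * of_int (p $ l))" for p
  proof -
    have "(\<Sum>i\<in>UNIV. \<Sum>l | l < i. \<theta> $ i $ l * of_int (axis j 1 $ i) * of_int (p $ l))
      = (\<Sum>i\<in>UNIV. if i = j then (\<Sum>l | l < j. \<theta> $ j $ l * of_int (p $ l)) else 0)"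
      by (intro sum.cong refl) (auto simp: axis_def)
    then show ?thesis by (simp add: twist_def)
  qed
  then show "coord (torus_U \<theta> j x) m = coord (left_shift \<theta> (axis j 1) x) m"
    by (simp add: torus_U.rep_eq phase_shift.rep_eq torus_phase_def)
qed

lemma left_shift_add:
  "left_shift \<theta> (p + q) x = scaleC (cis (- twist \<theta> p q)) (left_shift \<theta> p (left_shift \<theta> q x))"
proof -
  have "twist \<theta> (p + q) = (\<lambda>m. twist \<theta> p m + twist \<theta> q m)"
    by (simp add: fun_eq_iff twist_add_left)
  then show ?thesis
    by (simp add: phase_shift_phase_shift scaleC_cis_phase_shift twist_add_right)
qed

lemma left_shift_uminus:
  "left_shift \<theta> p (left_shift \<theta> (- p) x) = scaleC (cis (- twist \<theta> p p)) x"
proof -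
  have "phase_shift (\<lambda>_. c) 0 x = scaleC (cis c) x" for c
    by (rule ell2_eqI) (simp add: phase_shift.rep_eq scaleC.rep_eq)
  then show ?thesis
    by (simp add: phase_shift_phase_shift twist_diff_right)
qed

lemma commutantI:
  "bounded_op A \<Longrightarrow> (\<And>B. B \<in> S \<Longrightarrow> A \<circ> B = B \<circ> A) \<Longrightarrow> A \<in> commutant S"
  by (simp add: commutant_def)

lemma commutantD:
  assumes "A \<in> commutant S"
  shows "bounded_op A" "B \<in> S \<Longrightarrow> A \<circ> B = B \<circ> A"
  using assms by (auto simp: commutant_def)

text \<open>Left and right multiplications commute: by additivity of \<open>twist\<close> both
  composites carry the same phase. The adjoints of the generators belong to the generating set and
  are checked in the same way.\<close>

lemma right_shift_in_commutant:
  "right_shift \<theta> q \<in> commutant (range (torus_U \<theta>) \<union>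
     {B. bounded_op B \<and> (\<exists>A\<in>range (torus_U \<theta>). is_adjoint A B)})"
proof -
  have "right_shift \<theta> q \<circ> B = B \<circ> right_shift \<theta> q"
    if B: "B \<in> range (torus_U \<theta>) \<or> (\<exists>A\<in>range (torus_U \<theta>). is_adjoint A B)" for B
  proof -
    obtain j where j: "B = left_shift \<theta> (axis j 1) \<or>
        B = phase_shift (\<lambda>m. - twist \<theta> (axis j 1) (m - axis j 1)) (- axis j 1)"
      using B adjoint_phase_shift unfolding torus_U_eq_left_shift image_iff by blast
    have left: "right_shift \<theta> q \<circ> left_shift \<theta> p = left_shift \<theta> p \<circ> right_shift \<theta> q" for p
      by (rule ext) (simp add: phase_shift_phase_shift twist_add_left twist_add_right add_ac)
    have adj: "right_shift \<theta> q \<circ> phase_shift (\<lambda>m. - twist \<theta> p (m - p)) (- p)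
        = phase_shift (\<lambda>m. - twist \<theta> p (m - p)) (- p) \<circ> right_shift \<theta> q" for p
      by (rule ext) (simp add: phase_shift_phase_shift twist_diff_left twist_diff_right
          twist_add_right algebra_simps)
    from j show ?thesis
    proof
      assume "B = left_shift \<theta> (axis j 1)"
      then show ?thesis using left by simp
    next
      assume "B = phase_shift (\<lambda>m. - twist \<theta> (axis j 1) (m - axis j 1)) (- axis j 1)"
      then show ?thesis by (simp only: adj)
    qed
  qed
  then show ?thesis
    by (intro commutantI bounded_op_phase_shift) blast
qed

text \<open>The frequencies whose shift commutes with \<open>A\<close> form a subgroup, since the
  phases produced by sums and negatives pass through \<open>A\<close> by complex linearity. It
  contains the unit vectors, hence the whole lattice.\<close>

lemma commute_left_shift:
  assumes A: "bounded_op A" "\<And>j. A \<circ> torus_U \<theta> j = torus_U \<theta> j \<circ> A"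
  shows "A (left_shift \<theta> p x) = left_shift \<theta> p (A x)"
proof -
  define C where "C = {p. \<forall>x. A (left_shift \<theta> p x) = left_shift \<theta> p (A x)}"
  have linA: "A (scaleC c x) = scaleC c (A x)" for c x using A(1) by (simp add: bounded_op_def)
  have ax: "axis j 1 \<in> C" for j
    using fun_cong[OF A(2)[of j]] by (auto simp: C_def torus_U_eq_left_shift)
  have add: "p + q \<in> C" if "p \<in> C" "q \<in> C" for p q
    using that unfolding C_def by (auto simp: left_shift_add linA)
  have neg: "- p \<in> C" if "p \<in> C" for p
  proof -
    \<comment> \<open>As \<open>left_shift \<theta> p\<close> is injective, it is enough to compare
      after applying it; both sides are then the same scalar multiple of \<open>A x\<close>.\<close>
    have "left_shift \<theta> p (A (left_shift \<theta> (- p) x)) = left_shift \<theta> p (left_shift \<theta> (- p) (A x))" for x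
    proof -
      have "left_shift \<theta> p (A (left_shift \<theta> (- p) x)) = A (left_shift \<theta> p (left_shift \<theta> (- p) x))"
        using that by (simp add: C_def)
      then show ?thesis by (simp only: left_shift_uminus linA)
    qed
    then show ?thesis unfolding C_def using injD[OF inj_phase_shift] by blast
  qed
  have zero: "0 \<in> C"
    using add[OF ax[of undefined] neg[OF ax[of undefined]]] by simp
  have nat: "axis j (int r) \<in> C" for j r
  proof (induction r)
    case 0
    have "axis j (int 0) = 0" by (simp add: vec_eq_iff axis_def)
    then show ?case using zero by metis
  next
    case (Suc r)
    have "axis j (int (Suc r)) = axis j 1 + axis j (int r)" by (simp add: vec_eq_iff axis_def)
    then show ?case using add[OF ax Suc] by simp
  qed
  have int: "axis j z \<in> C" for j z
  proof -
    have "axis j (- int r) = - axis j (int r)" for r by (simp add: vec_eq_iff axis_def)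
    then show ?thesis using nat[of j] neg[OF nat[of j]] by (cases z rule: int_cases2) auto
  qed
  have "(\<Sum>j\<in>F. axis j (p $ j)) \<in> C" if "finite F" for F
    using that by (induction F) (auto simp: zero int add)
  moreover have "(\<Sum>j\<in>UNIV. axis j (p $ j)) = p"
    by (simp add: vec_eq_iff axis_def)
  ultimately have "p \<in> C" using finite by metis
  then show ?thesis by (simp add: C_def)
qed

section \<open>Left multiplication by elements with summable Fourier coefficients\<close>

text \<open>Left multiplication by the Fourier series of \<open>a\<close>. The sum is taken over
  vectors in norm rather than coordinate by coordinate, so that it can be pulled through bounded
  operators directly.\<close>

definition twisted_mult ::
    "('n::{finite,linorder}) torus_matrix \<Rightarrow> 'n torus_L2 \<Rightarrow> 'n torus_L2 \<Rightarrow> 'n torus_L2" where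
  "twisted_mult \<theta> a x = (\<Sum>\<^sub>\<infinity>p. scaleC (coord a p) (left_shift \<theta> p x))"

context
  fixes \<theta> :: "('n::{finite,linorder}) torus_matrix" and a :: "'n torus_L2"
  assumes a: "(\<lambda>p. cmod (coord a p)) summable_on UNIV"
begin

lemma twisted_mult_abs_summable:
  "(\<lambda>p. norm (scaleC (coord a p) (left_shift \<theta> p x))) summable_on UNIV"
  using summable_on_cmult_left[OF a] by (simp add: norm_scaleC)

lemma has_sum_twisted_mult:
  "((\<lambda>p. scaleC (coord a p) (left_shift \<theta> p x)) has_sum twisted_mult \<theta> a x) UNIV"
  unfolding twisted_mult_def
  by (rule has_sum_infsum[OF abs_summable_summable[OF twisted_mult_abs_summable]])

lemma norm_twisted_mult_le: "norm (twisted_mult \<theta> a x) \<le> (\<Sum>\<^sub>\<infinity>p. cmod (coord a p)) * norm x"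
proof -
  have "norm (twisted_mult \<theta> a x) \<le> (\<Sum>\<^sub>\<infinity>p. cmod (coord a p) * norm x)"
    unfolding twisted_mult_def
    using norm_infsum_bound[OF twisted_mult_abs_summable[of x]] by (simp add: norm_scaleC)
  then show ?thesis by (simp add: infsum_cmult_left[OF a])
qed

lemma has_sum_coord_twisted_mult:
  "((\<lambda>p. coord a p * cis (twist \<theta> p (m - p)) * coord x (m - p)) has_sum coord (twisted_mult \<theta> a x) m) UNIV"
  using has_sum_bounded_linear[OF bounded_linear_coord[of m] has_sum_twisted_mult[of x]]
  by (simp add: scaleC.rep_eq phase_shift.rep_eq mult.assoc)

lemma twisted_mult_basis_vec_0: "twisted_mult \<theta> a (basis_vec 0) = a"
proof (rule ell2_eqI)
  fix m :: "'n freq"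
  have "((\<lambda>p. coord a p * cis (twist \<theta> p (m - p)) * coord (basis_vec 0) (m - p)) has_sum coord a m) UNIV"
    using has_sum_finite[of "{m}" "\<lambda>_. coord a m"]
    by (subst has_sum_cong_neutral[where T = "{m}" and g = "\<lambda>_. coord a m"]) (auto simp: coord_basis_vec)
  then show "coord (twisted_mult \<theta> a (basis_vec 0)) m = coord a m"
    using has_sum_coord_twisted_mult has_sum_unique by blast
qed

lemma bounded_op_twisted_mult: "bounded_op (twisted_mult \<theta> a)"
proof -
  have lin: "linear (left_shift \<theta> p)" and lin': "left_shift \<theta> p (scaleC c x) = scaleC c (left_shift \<theta> p x)" for p c x
    using bounded_op_phase_shift[of "twist \<theta> p" p] by (auto simp: bounded_op_def bounded_linear.linear)
  have linC: "bounded_linear (scaleC c :: 'n torus_L2 \<Rightarrow> _)" for c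
    using bounded_op_scaleC[of c] unfolding bounded_op_def by blast
  have "twisted_mult \<theta> a (x + y) = twisted_mult \<theta> a x + twisted_mult \<theta> a y" for x y
    using has_sum_add[OF has_sum_twisted_mult[of x] has_sum_twisted_mult[of y]]
    by (intro has_sum_unique[OF has_sum_twisted_mult[of "x + y"]])
      (simp add: linear_add lin linC bounded_linear.linear)
  moreover have "twisted_mult \<theta> a (r *\<^sub>R x) = r *\<^sub>R twisted_mult \<theta> a x" for r x
    using has_sum_bounded_linear[OF bounded_linear_scaleR_right[of r] has_sum_twisted_mult[of x]]
    by (intro has_sum_unique[OF has_sum_twisted_mult[of "r *\<^sub>R x"]])
      (simp add: linear_scale lin linC bounded_linear.linear)
  moreover have "twisted_mult \<theta> a (scaleC c x) = scaleC c (twisted_mult \<theta> a x)" for c x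
  proof -
    have "scaleC c (scaleC (coord a p) (left_shift \<theta> p x))
        = scaleC (coord a p) (left_shift \<theta> p (scaleC c x))" for p
      by (simp add: lin') (simp add: scaleC.rep_eq ell2_eqI)
    then show ?thesis
      using has_sum_bounded_linear[OF linC[of c] has_sum_twisted_mult[of x]]
      by (intro has_sum_unique[OF has_sum_twisted_mult[of "scaleC c x"]]) simp
  qed
  ultimately show ?thesis
    unfolding bounded_op_def
    by (intro conjI allI bounded_linear_intro[of _ "\<Sum>\<^sub>\<infinity>p. cmod (coord a p)"])
      (simp_all add: norm_twisted_mult_le mult.commute[of "norm _"])
qed

text \<open>An operator commuting with the generators commutes with every left shift, and by
  continuity with the norm-convergent series. This is membership in the double commutant.\<close>

lemma twisted_mult_in_torus_Linf: "twisted_mult \<theta> a \<in> torus_Linf \<theta>"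
proof -
  have comm: "twisted_mult \<theta> a (A x) = A (twisted_mult \<theta> a x)"
    if A: "bounded_op A" "\<And>j. A \<circ> torus_U \<theta> j = torus_U \<theta> j \<circ> A" for A x
  proof -
    have "bounded_linear A" using A(1) by (simp add: bounded_op_def)
    from has_sum_bounded_linear[OF this has_sum_twisted_mult[of x]]
    have sum: "((\<lambda>p. A (scaleC (coord a p) (left_shift \<theta> p x))) has_sum A (twisted_mult \<theta> a x)) UNIV" .
    have "A (scaleC (coord a p) (left_shift \<theta> p x)) = scaleC (coord a p) (left_shift \<theta> p (A x))" for p
      using commute_left_shift[OF A] A(1) unfolding bounded_op_def by metis
    with sum show ?thesis
      by (intro has_sum_unique[OF has_sum_twisted_mult[of "A x"]]) simp
  qed
  have "twisted_mult \<theta> a \<circ> A = A \<circ> twisted_mult \<theta> a"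
    if "A \<in> commutant (range (torus_U \<theta>) \<union> S)" for A S
  proof -
    have "A \<circ> torus_U \<theta> j = torus_U \<theta> j \<circ> A" for j
      by (rule commutantD(2)[OF that]) simp
    note this = commutantD(1)[OF that] this
    from comm[OF this] show ?thesis by (simp add: fun_eq_iff)
  qed
  then show ?thesis
    unfolding torus_Linf_def vN_generated_def
    by (intro commutantI bounded_op_twisted_mult)
qed

text \<open>The vector \<open>e\<^sub>0\<close> is separating because the right shifts lie in the commutant and move it to
  every basis vector.\<close>

lemma torus_op_eq_twisted_mult: "torus_op \<theta> a = twisted_mult \<theta> a"
  unfolding torus_op_def
proof (rule the_equality)
  show "twisted_mult \<theta> a \<in> torus_Linf \<theta> \<and> twisted_mult \<theta> a (basis_vec 0) = a"
    using twisted_mult_in_torus_Linf twisted_mult_basis_vec_0 by blast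
next
  fix x assume x: "x \<in> torus_Linf \<theta> \<and> x (basis_vec 0) = a"
  have comm: "y (basis_vec q) = right_shift \<theta> q (y (basis_vec 0))" and bdd: "bounded_op y"
    if y: "y \<in> torus_Linf \<theta>" for y q
  proof -
    show "bounded_op y"
      using y unfolding torus_Linf_def vN_generated_def by (rule commutantD)
    have "y \<circ> right_shift \<theta> q = right_shift \<theta> q \<circ> y"
      using y right_shift_in_commutant unfolding torus_Linf_def vN_generated_def by (rule commutantD)
    then have "y (right_shift \<theta> q (basis_vec 0)) = right_shift \<theta> q (y (basis_vec 0))"
      by (simp add: fun_eq_iff)
    moreover have "right_shift \<theta> q (basis_vec 0) = basis_vec q"
      by (rule ell2_eqI) (simp add: phase_shift_basis_vec scaleC.rep_eq)
    ultimately show "y (basis_vec q) = right_shift \<theta> q (y (basis_vec 0))" by simp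
  qed
  show "x = twisted_mult \<theta> a"
  proof (rule bounded_op_eqI)
    show "x (basis_vec q) = twisted_mult \<theta> a (basis_vec q)" for q
      using x comm[of x q] comm[OF twisted_mult_in_torus_Linf, of q] twisted_mult_basis_vec_0 by metis
  qed (use x bdd bounded_op_twisted_mult in auto)
qed

end

text \<open>The operator of \<open>b\<close> sends the vector \<open>basis_vec 0\<close> back to
  \<open>b\<close>, so only the operator of \<open>a\<close> remains. From here on a product is a
  twisted convolution of coefficients.\<close>

lemma torus_times_eq_twisted_mult:
  assumes "(\<lambda>p. cmod (coord a p)) summable_on UNIV" "(\<lambda>p. cmod (coord b p)) summable_on UNIV"
  shows "torus_times \<theta> a b = twisted_mult \<theta> a b"
  by (simp add: torus_times_def torus_op_eq_twisted_mult assms twisted_mult_basis_vec_0)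

section \<open>Sobolev spaces\<close>

definition sobolev_weight :: "('n::finite) freq \<Rightarrow> real" where
  "sobolev_weight m = 1 + 4 * pi\<^sup>2 * freq_sq m"

lemma freq_sq_nonneg: "freq_sq m \<ge> 0"
  by (simp add: freq_sq_def sum_nonneg)

lemma sobolev_weight_ge_1: "sobolev_weight m \<ge> 1"
  by (simp add: sobolev_weight_def freq_sq_nonneg)

lemma sobolev_weight_pos: "sobolev_weight m > 0"
  using sobolev_weight_ge_1[of m] by simp

lemma mem_sobolev_iff:
  "a \<in> sobolev \<theta> s \<longleftrightarrow> (\<lambda>m. sobolev_weight m powr s * (cmod (coord a m))\<^sup>2) summable_on UNIV"
  by (simp add: sobolev_def sobolev_weight_def fourier_eq_coord)

lemma sobolev_norm_eq:
  "sobolev_norm \<theta> s a = sqrt (\<Sum>\<^sub>\<infinity>m. sobolev_weight m powr s * (cmod (coord a m))\<^sup>2)"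
  by (simp add: sobolev_norm_def sobolev_weight_def fourier_eq_coord)

lemma sobolev_norm_nonneg [simp]: "sobolev_norm \<theta> s a \<ge> 0"
  by (simp add: sobolev_norm_eq infsum_nonneg)

lemma sum_le_sobolev_norm:
  assumes "a \<in> sobolev \<theta> s" "finite F"
  shows "(\<Sum>m\<in>F. sobolev_weight m powr s * (cmod (coord a m))\<^sup>2) \<le> (sobolev_norm \<theta> s a)\<^sup>2"
  using assms
  by (simp add: sobolev_norm_eq infsum_nonneg mem_sobolev_iff finite_sum_le_infsum)

text \<open>Membership and norm bound come together from finite partial sums; later estimates thus
  only interchange finite sums with time integrals.\<close>

lemma sobolev_finite_sumsI:
  assumes "\<And>F. finite F \<Longrightarrow> (\<Sum>m\<in>F. sobolev_weight m powr s * (cmod (coord a m))\<^sup>2) \<le> B"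
  shows "a \<in> sobolev \<theta> s" "(sobolev_norm \<theta> s a)\<^sup>2 \<le> B"
proof -
  show mem: "a \<in> sobolev \<theta> s"
    unfolding mem_sobolev_iff
    by (rule nonneg_bdd_above_summable_on) (auto intro!: bdd_aboveI[of _ B] assms)
  then show "(sobolev_norm \<theta> s a)\<^sup>2 \<le> B"
    by (simp add: sobolev_norm_eq infsum_nonneg mem_sobolev_iff infsum_le_finite_sums assms)
qed

text \<open>Reduces a Sobolev estimate to a coordinatewise comparison with a vector \<open>v\<close>
  of \<ell>2, usually built from images under \<open>sobolev_iso\<close> or from a
  convolution.\<close>

lemma sobolev_dominatedI:
  assumes "\<And>m. sobolev_weight m powr (s / 2) * cmod (coord a m) \<le> C * cmod (coord v m)" "C \<ge> 0"
  shows "a \<in> sobolev \<theta> s" "sobolev_norm \<theta> s a \<le> C * norm v"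
proof -
  have le: "(\<Sum>m\<in>F. sobolev_weight m powr s * (cmod (coord a m))\<^sup>2) \<le> (C * norm v)\<^sup>2" if "finite F" for F
  proof -
    have "sobolev_weight m powr s * (cmod (coord a m))\<^sup>2 \<le> C\<^sup>2 * (cmod (coord v m))\<^sup>2" for m
    proof -
      have "sobolev_weight m powr s = (sobolev_weight m powr (s / 2))\<^sup>2"
        by (simp add: power2_eq_square powr_add[symmetric])
      then show ?thesis
        using power_mono[OF assms(1)[of m], of 2] by (simp add: power_mult_distrib)
    qed
    then have "(\<Sum>m\<in>F. sobolev_weight m powr s * (cmod (coord a m))\<^sup>2) \<le> (\<Sum>m\<in>F. C\<^sup>2 * (cmod (coord v m))\<^sup>2)"
      by (intro sum_mono)
    also have "\<dots> \<le> C\<^sup>2 * (norm v)\<^sup>2"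
      unfolding sum_distrib_left[symmetric] by (intro mult_left_mono sum_coord_le_norm that) auto
    finally show ?thesis by (simp add: power_mult_distrib)
  qed
  show "a \<in> sobolev \<theta> s" by (rule sobolev_finite_sumsI(1)[OF le])
  have "(sobolev_norm \<theta> s a)\<^sup>2 \<le> (C * norm v)\<^sup>2" by (rule sobolev_finite_sumsI(2)[OF le])
  then show "sobolev_norm \<theta> s a \<le> C * norm v"
    by (rule power2_le_imp_le) (simp add: assms)
qed

lemma coord_sobolev_iso:
  assumes "a \<in> sobolev \<theta> s"
  shows "coord (sobolev_iso \<theta> s a) m = of_real (sobolev_weight m powr (s / 2)) * coord a m"
proof -
  have "(cmod (of_real (sobolev_weight m powr (s / 2)) * coord a m))\<^sup>2
      = sobolev_weight m powr s * (cmod (coord a m))\<^sup>2" for m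
    by (simp add: norm_mult power_mult_distrib power2_eq_square powr_add[symmetric])
  then show ?thesis
    using fourier_fourier_mult[of "\<lambda>m. sobolev_weight m powr (s / 2)" \<theta> a m] assms
    by (simp add: mem_sobolev_iff sobolev_iso_def fourier_eq_coord sobolev_weight_def)
qed

lemma cmod_coord_sobolev_iso:
  assumes "a \<in> sobolev \<theta> s"
  shows "cmod (coord (sobolev_iso \<theta> s a) m) = sobolev_weight m powr (s / 2) * cmod (coord a m)"
  by (simp add: coord_sobolev_iso[OF assms] norm_mult)

lemma sobolev_mono:
  assumes "a \<in> sobolev \<theta> s" "s' \<le> s"
  shows "a \<in> sobolev \<theta> s'" "sobolev_norm \<theta> s' a \<le> sobolev_norm \<theta> s a"
proof -
  have "sobolev_weight m powr (s' / 2) * cmod (coord a m) \<le> 1 * cmod (coord (sobolev_iso \<theta> s a) m)" for m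
    using assms(2) sobolev_weight_ge_1[of m]
    by (simp add: cmod_coord_sobolev_iso[OF assms(1)] mult_right_mono powr_mono)
  from sobolev_dominatedI[OF this] show "a \<in> sobolev \<theta> s'" "sobolev_norm \<theta> s' a \<le> sobolev_norm \<theta> s a"
    by (simp_all add: norm_sobolev_iso[OF assms(1)])
qed

lemma sobolev_add:
  assumes "a \<in> sobolev \<theta> s" "b \<in> sobolev \<theta> s"
  shows "a + b \<in> sobolev \<theta> s" "sobolev_norm \<theta> s (a + b) \<le> sobolev_norm \<theta> s a + sobolev_norm \<theta> s b"
proof -
  let ?v = "sobolev_iso \<theta> s a + sobolev_iso \<theta> s b"
  have "sobolev_weight m powr (s / 2) * cmod (coord (a + b) m) \<le> 1 * cmod (coord ?v m)" for m
    by (simp add: plus_ell2.rep_eq coord_sobolev_iso assms distrib_left[symmetric] norm_mult)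
  from sobolev_dominatedI[OF this, of \<theta>]
  show "a + b \<in> sobolev \<theta> s" "sobolev_norm \<theta> s (a + b) \<le> sobolev_norm \<theta> s a + sobolev_norm \<theta> s b"
    using norm_triangle_ineq[of "sobolev_iso \<theta> s a" "sobolev_iso \<theta> s b"]
    by (simp_all add: norm_sobolev_iso assms)
qed

lemma sobolev_diff:
  assumes "a \<in> sobolev \<theta> s" "b \<in> sobolev \<theta> s"
  shows "a - b \<in> sobolev \<theta> s" "sobolev_norm \<theta> s (a - b) \<le> sobolev_norm \<theta> s a + sobolev_norm \<theta> s b"
proof -
  have "coord (- b) = (\<lambda>m. - coord b m)" by (simp add: uminus_ell2.rep_eq fun_eq_iff)
  then have "- b \<in> sobolev \<theta> s" "sobolev_norm \<theta> s (- b) = sobolev_norm \<theta> s b"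
    using assms(2) by (simp_all add: mem_sobolev_iff sobolev_norm_eq)
  then show "a - b \<in> sobolev \<theta> s" "sobolev_norm \<theta> s (a - b) \<le> sobolev_norm \<theta> s a + sobolev_norm \<theta> s b"
    using sobolev_add[of a \<theta> s "- b"] assms(1) by simp_all
qed

text \<open>Cauchy-Schwarz, with the weight of exponent (s + s')/2 split into a factor of exponent
  s/2 and one of exponent s'/2.\<close>

lemma sobolev_norm_interpolation:
  assumes "a \<in> sobolev \<theta> s" "a \<in> sobolev \<theta> s'"
  shows "(sobolev_norm \<theta> ((s + s') / 2) a)\<^sup>2 \<le> sobolev_norm \<theta> s a * sobolev_norm \<theta> s' a"
proof (rule sobolev_finite_sumsI(2))
  fix F :: "'a freq set" assume F: "finite F"
  let ?f = "\<lambda>s m. sobolev_weight m powr (s / 2) * cmod (coord a m)"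
  have sq: "(?f s m)\<^sup>2 = sobolev_weight m powr s * (cmod (coord a m))\<^sup>2" for s m
    by (simp add: power_mult_distrib power2_eq_square powr_add[symmetric])
  have "sobolev_weight m powr ((s + s') / 2) * (cmod (coord a m))\<^sup>2 = ?f s m * ?f s' m" for m
    by (simp add: power2_eq_square powr_add add_divide_distrib mult_ac)
  then have "(\<Sum>m\<in>F. sobolev_weight m powr ((s + s') / 2) * (cmod (coord a m))\<^sup>2)\<^sup>2
      \<le> (\<Sum>m\<in>F. (?f s m)\<^sup>2) * (\<Sum>m\<in>F. (?f s' m)\<^sup>2)"
    using Cauchy_Schwarz_ineq_sum[of "?f s" "?f s'" F] by simp
  also have "\<dots> \<le> (sobolev_norm \<theta> s a)\<^sup>2 * (sobolev_norm \<theta> s' a)\<^sup>2"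
    unfolding sq using sum_le_sobolev_norm[OF assms(1) F] sum_le_sobolev_norm[OF assms(2) F]
    by (intro mult_mono) (auto intro: sum_nonneg)
  finally show "(\<Sum>m\<in>F. sobolev_weight m powr ((s + s') / 2) * (cmod (coord a m))\<^sup>2)
      \<le> sobolev_norm \<theta> s a * sobolev_norm \<theta> s' a"
    unfolding power_mult_distrib[symmetric] by (rule power2_le_imp_le) simp
qed

section \<open>Lattice sums and the embedding into absolutely summable Fourier series\<close>

lemma summable_on_int_inverse_power:
  assumes "t > 1 / 2"
  shows "(\<lambda>z::int. (1 + (of_int z)\<^sup>2) powr (- t) :: real) summable_on UNIV"
proof -
  let ?g = "\<lambda>z::int. (1 + (of_int z)\<^sup>2) powr (- t) :: real"
  have "summable (\<lambda>n. real n powr (- 2 * t))"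
    using assms by (simp add: summable_real_powr_iff)
  then have "summable (\<lambda>n. (1 + (real n)\<^sup>2) powr (- t))"
  proof (rule summable_comparison_test_ev[rotated])
    show "\<forall>\<^sub>F n in sequentially. norm ((1 + (real n)\<^sup>2) powr (- t)) \<le> real n powr (- 2 * t)"
      \<comment> \<open>At n = 0 the comparison fails, because \<open>0 powr x\<close> is 0 while
        the left side is 1.\<close>
      using eventually_gt_at_top[of 0]
    proof eventually_elim
      case (elim n)
      have "(1 + (real n)\<^sup>2) powr (- t) \<le> ((real n)\<^sup>2) powr (- t)"
        using elim assms by (intro powr_mono2') auto
      also have "\<dots> = real n powr (- 2 * t)"
        using elim by (simp add: powr_powr flip: powr_numeral)
      finally show ?case by simp
    qed
  qed
  then have nat: "(\<lambda>n. (1 + (real n)\<^sup>2) powr (- t)) summable_on UNIV"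
    by (subst summable_on_UNIV_nonneg_real_iff) auto
  have pos: "?g summable_on range int"
    by (subst summable_on_reindex) (use nat in \<open>simp_all add: comp_def\<close>)
  \<comment> \<open>The successor leaves out 0, which \<open>range int\<close> already contains, so
    the two halves of the integers are disjoint.\<close>
  have "?g (- int (Suc n)) \<le> (1 + (real n)\<^sup>2) powr (- t)" for n
  proof (rule powr_mono2')
    show "1 + (real n)\<^sup>2 \<le> 1 + (of_int (- int (Suc n)))\<^sup>2"
      by (simp add: power2_eq_square algebra_simps)
    show "0 < 1 + (real n)\<^sup>2" by (intro add_pos_nonneg) auto
  qed (use assms in simp)
  then have "(\<lambda>n. ?g (- int (Suc n))) summable_on UNIV"
    by (intro summable_on_comparison_test[OF nat]) auto
  moreover have "inj (\<lambda>n. - int (Suc n))" by (rule injI) simp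
  ultimately have neg: "?g summable_on range (\<lambda>n. - int (Suc n))"
    by (subst summable_on_reindex) (simp_all add: comp_def)
  have "range int \<inter> range (\<lambda>n. - int (Suc n)) = {}" by auto
  then have "?g summable_on (range int \<union> range (\<lambda>n. - int (Suc n)))"
    by (rule summable_on_Un_disjoint[OF pos neg])
  moreover have "z \<in> range int \<union> range (\<lambda>n. - int (Suc n))" for z
    by (cases z rule: int_cases) blast+
  then have "range int \<union> range (\<lambda>n. - int (Suc n)) = UNIV" by blast
  ultimately show ?thesis by simp
qed

text \<open>The lattice sum is dominated by a product of one-dimensional sums, since
  \<open>(1 + |m|\<^sup>2)\<^sup>n \<ge> \<Prod>\<^sub>j (1 + m\<^sub>j\<^sup>2)\<close>.\<close>

lemma summable_on_sobolev_weight: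
  assumes s: "s > real CARD('n::finite) / 2"
  shows "(\<lambda>m::'n freq. sobolev_weight m powr (- s)) summable_on UNIV"
proof (rule nonneg_bdd_above_summable_on)
  \<comment> \<open>The decay is shared equally among the coordinates; s > n/2 becomes t > 1/2, the
    threshold for the one-dimensional sum.\<close>
  define t where "t = s / real CARD('n)"
  have card: "real CARD('n) > 0" by simp
  have t: "t > 1 / 2" using s by (simp add: t_def field_simps)
  define g where "g = (\<lambda>z::int. (1 + (of_int z)\<^sup>2) powr (- t) :: real)"
  have g: "g summable_on UNIV" unfolding g_def using t by (rule summable_on_int_inverse_power)
  have le: "sobolev_weight m powr (- s) \<le> (\<Prod>j\<in>UNIV. g (m $ j))" for m :: "'n freq"
  proof -
    have "sobolev_weight m powr (- t) \<le> g (m $ j)" for j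
    proof -
      have "(of_int (m $ j))\<^sup>2 \<le> freq_sq m"
        unfolding freq_sq_def by (rule member_le_sum) auto
      also have "\<dots> \<le> 4 * pi\<^sup>2 * freq_sq m"
      proof -
        have "1 \<le> pi\<^sup>2" using pi_ge_two by (intro one_le_power) auto
        then show ?thesis using freq_sq_nonneg[of m] mult_right_mono[of 1 "4 * pi\<^sup>2" "freq_sq m"] by simp
      qed
      finally show ?thesis
        unfolding g_def sobolev_weight_def using t
        by (intro powr_mono2') (auto intro: add_pos_nonneg)
    qed
    then have "(\<Prod>j\<in>(UNIV::'n set). sobolev_weight m powr (- t)) \<le> (\<Prod>j\<in>UNIV. g (m $ j))"
      by (intro prod_mono) auto
    also have "(\<Prod>j\<in>(UNIV::'n set). sobolev_weight m powr (- t)) = sobolev_weight m powr (- s)"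
      using sobolev_weight_pos[of m] card
      by (simp add: t_def powr_realpow[symmetric] powr_powr del: card)
    finally show ?thesis .
  qed
  show "bdd_above (sum (\<lambda>m::'n freq. sobolev_weight m powr (- s)) ` {F. F \<subseteq> UNIV \<and> finite F})"
  proof (rule bdd_aboveI2)
    fix F :: "'n freq set" assume "F \<in> {F. F \<subseteq> UNIV \<and> finite F}"
    then have F: "finite F" by simp
    \<comment> \<open>All coordinate values that occur in \<open>F\<close>. Thus \<open>F\<close>
      embeds into the box of all functions with values in \<open>G\<close>, and over that box the
      sum of products factorizes.\<close>
    define G where "G = (\<Union>m\<in>F. range (($) m))"
    have G: "finite G" using F by (auto simp: G_def)
    have inj: "inj_on ($) F" by (auto simp: inj_on_def vec_nth_inject)
    have "(\<Sum>m\<in>F. sobolev_weight m powr (- s)) \<le> (\<Sum>m\<in>F. \<Prod>j\<in>UNIV. g (m $ j))"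
      by (intro sum_mono le)
    also have "\<dots> = (\<Sum>h\<in>($) ` F. \<Prod>j\<in>UNIV. g (h j))"
      by (simp add: sum.reindex[OF inj])
    also have "\<dots> \<le> (\<Sum>h\<in>PiE (UNIV :: 'n set) (\<lambda>_. G). \<Prod>j\<in>UNIV. g (h j))"
    proof (rule sum_mono2)
      show "finite (PiE (UNIV :: 'n set) (\<lambda>_. G))" using G by (intro finite_PiE) auto
      have "range (($) m) \<subseteq> G" if "m \<in> F" for m using that unfolding G_def by blast
      then show "($) ` F \<subseteq> PiE (UNIV :: 'n set) (\<lambda>_. G)"
        unfolding PiE_UNIV_domain by blast
      show "0 \<le> (\<Prod>j\<in>(UNIV :: 'n set). g (h j))" for h by (intro prod_nonneg) (simp add: g_def)
    qed
    also have "\<dots> = (\<Prod>j\<in>(UNIV::'n set). \<Sum>z\<in>G. g z)"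
      using G by (intro prod_sum_PiE[symmetric]) auto
    also have "\<dots> \<le> (\<Prod>j\<in>(UNIV::'n set). infsum g UNIV)"
      using G g by (intro prod_mono conjI sum_nonneg finite_sum_le_infsum) (auto simp: g_def)
    finally show "(\<Sum>m\<in>F. sobolev_weight m powr (- s)) \<le> (\<Prod>j\<in>(UNIV::'n set). infsum g UNIV)" .
  qed
qed auto

text \<open>Cauchy-Schwarz against the negative power of the weight. The condition s > n/2 enters
  here, through the convergence of the lattice sum.\<close>

lemma sobolev_abs_summable:
  fixes a :: "('n::{finite,linorder}) torus_L2"
  assumes s: "s > real CARD('n) / 2" and a: "a \<in> sobolev \<theta> s"
  shows "(\<lambda>m. cmod (coord a m)) summable_on UNIV"
    and "(\<Sum>\<^sub>\<infinity>m. cmod (coord a m)) \<le> sqrt (\<Sum>\<^sub>\<infinity>m::'n freq. sobolev_weight m powr (- s)) * sobolev_norm \<theta> s a"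
proof -
  let ?S = "\<Sum>\<^sub>\<infinity>m::'n freq. sobolev_weight m powr (- s)"
  have S: "?S \<ge> 0" by (simp add: infsum_nonneg)
  have le: "(\<Sum>m\<in>F. cmod (coord a m)) \<le> sqrt ?S * sobolev_norm \<theta> s a" if F: "finite F" for F
  proof (rule power2_le_imp_le)
    let ?f = "\<lambda>m::'n freq. sobolev_weight m powr (- s / 2)"
    let ?g = "\<lambda>m. sobolev_weight m powr (s / 2) * cmod (coord a m)"
    have "?f m * ?g m = cmod (coord a m)" for m
    proof -
      have "?f m * sobolev_weight m powr (s / 2) = 1"
        using sobolev_weight_pos[of m] by (simp flip: powr_add)
      then show ?thesis unfolding mult.assoc[symmetric] by simp
    qed
    then have "(\<Sum>m\<in>F. cmod (coord a m))\<^sup>2 = (\<Sum>m\<in>F. ?f m * ?g m)\<^sup>2"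
      by (simp only:)
    also have "\<dots> \<le> (\<Sum>m\<in>F. (?f m)\<^sup>2) * (\<Sum>m\<in>F. (?g m)\<^sup>2)"
      by (rule Cauchy_Schwarz_ineq_sum)
    also have "\<dots> = (\<Sum>m\<in>F. sobolev_weight m powr (- s)) *
        (\<Sum>m\<in>F. sobolev_weight m powr s * (cmod (coord a m))\<^sup>2)"
    proof -
      have "(sobolev_weight m powr t)\<^sup>2 = sobolev_weight m powr (2 * t)" for m :: "'n freq" and t
        by (simp add: power2_eq_square powr_add[symmetric])
      then show ?thesis by (simp add: power_mult_distrib)
    qed
    also have "\<dots> \<le> ?S * (sobolev_norm \<theta> s a)\<^sup>2"
      using sum_le_sobolev_norm[OF a F] summable_on_sobolev_weight[OF s] F S
      by (intro mult_mono finite_sum_le_infsum) (auto intro: sum_nonneg)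
    finally show "(\<Sum>m\<in>F. cmod (coord a m))\<^sup>2 \<le> (sqrt ?S * sobolev_norm \<theta> s a)\<^sup>2"
      using S by (simp add: power_mult_distrib)
  qed (simp add: S)
  show sum: "(\<lambda>m. cmod (coord a m)) summable_on UNIV"
    by (rule nonneg_bdd_above_summable_on)
      (auto intro!: bdd_aboveI[of _ "sqrt ?S * sobolev_norm \<theta> s a"] le)
  show "(\<Sum>\<^sub>\<infinity>m. cmod (coord a m)) \<le> sqrt ?S * sobolev_norm \<theta> s a"
    by (rule infsum_le_finite_sums[OF sum le])
qed

text \<open>The constant 4 is 2 from |m|^2 \<le> 2|p|^2 + 2|m-p|^2 times 2 from replacing a sum by
  twice its maximum. With the maximum, every exponent s \<ge> 0 is handled without a convexity
  argument.\<close>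

lemma sobolev_weight_powr_le:
  assumes "s \<ge> 0"
  shows "sobolev_weight m powr s \<le> 4 powr s * (sobolev_weight p powr s + sobolev_weight (m - p) powr s)"
proof -
  let ?M = "max (sobolev_weight p) (sobolev_weight (m - p))"
  have "freq_sq m \<le> 2 * freq_sq p + 2 * freq_sq (m - p)"
  proof -
    have "(of_int (m $ i))\<^sup>2 \<le> (2 * (of_int (p $ i))\<^sup>2 + 2 * (of_int ((m - p) $ i))\<^sup>2 :: real)" for i
      \<comment> \<open>The right side minus the left side is exactly this square.\<close>
      using zero_le_power2[of "of_int (m $ i) - 2 * of_int (p $ i) :: real"]
      by (simp add: power2_eq_square algebra_simps)
    then show ?thesis
      unfolding freq_sq_def sum_distrib_left sum.distrib[symmetric] by (intro sum_mono)
  qed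
  then have "4 * pi\<^sup>2 * freq_sq m \<le> 4 * pi\<^sup>2 * (2 * freq_sq p + 2 * freq_sq (m - p))"
    by (intro mult_left_mono) auto
  then have "sobolev_weight m \<le> 2 * sobolev_weight p + 2 * sobolev_weight (m - p)"
    by (simp add: sobolev_weight_def algebra_simps)
  then have "sobolev_weight m \<le> 4 * ?M" by simp
  then have "sobolev_weight m powr s \<le> (4 * ?M) powr s"
    using assms sobolev_weight_pos[of m] by (intro powr_mono2) auto
  also have "\<dots> = 4 powr s * ?M powr s"
    by (rule powr_mult)
  also have "\<dots> \<le> 4 powr s * (sobolev_weight p powr s + sobolev_weight (m - p) powr s)"
    by (intro mult_left_mono) (auto simp: max_def)
  finally show ?thesis .
qed

section \<open>The Sobolev algebra\<close>

text \<open>Young's inequality, read off from the operator norm of the untwisted multiplication (\<open>\<theta> = 0\<close>)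
  by absolute values.\<close>

lemma Young_convolution:
  fixes \<alpha> \<beta> :: "('n::{finite,linorder}) torus_L2"
  assumes "(\<lambda>p. cmod (coord \<alpha> p)) summable_on UNIV"
  obtains v :: "'n torus_L2" and r
  where "\<And>m. ((\<lambda>p. cmod (coord \<alpha> p) * cmod (coord \<beta> (m - p))) has_sum r m) UNIV"
    and "\<And>m. coord v m = of_real (r m)" "\<And>m. r m \<ge> 0"
    and "norm v \<le> (\<Sum>\<^sub>\<infinity>p. cmod (coord \<alpha> p)) * norm \<beta>"
proof -
  define ab :: "'n torus_L2 \<Rightarrow> 'n torus_L2" where "ab = (\<lambda>x. Abs_ell2 (\<lambda>i. of_real (cmod (coord x i))))"
  have ab: "coord (ab x) i = of_real (cmod (coord x i))" for x i
    unfolding ab_def by (subst Abs_ell2_inverse) (auto simp: coord_square_summable)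
  have norm_ab: "norm (ab x) = norm x" for x
  proof -
    have "(norm (ab x))\<^sup>2 = (norm x)\<^sup>2" by (simp add: norm_ell2_square ab)
    then show ?thesis by (simp add: power2_eq_iff_nonneg)
  qed
  define v where "v = twisted_mult 0 (ab \<alpha>) (ab \<beta>)"
  have summ: "(\<lambda>p. cmod (coord (ab \<alpha>) p)) summable_on UNIV" using assms by (simp add: ab)
  have sum: "((\<lambda>p. complex_of_real (cmod (coord \<alpha> p) * cmod (coord \<beta> (m - p)))) has_sum coord v m) UNIV" for m
    using has_sum_coord_twisted_mult[OF summ, of 0 m "ab \<beta>"] by (simp add: ab v_def twist_def)
  have r: "((\<lambda>p. cmod (coord \<alpha> p) * cmod (coord \<beta> (m - p))) has_sum Re (coord v m)) UNIV" for m
    using has_sum_Re[OF sum[of m]] by simp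
  show thesis
  proof
    show "((\<lambda>p. cmod (coord \<alpha> p) * cmod (coord \<beta> (m - p))) has_sum Re (coord v m)) UNIV" for m
      by (rule r)
    show "Re (coord v m) \<ge> 0" for m by (rule has_sum_nonneg[OF r]) simp
    show "coord v m = of_real (Re (coord v m))" for m
      by (rule has_sum_unique[OF sum has_sum_of_real[OF r]])
    show "norm v \<le> (\<Sum>\<^sub>\<infinity>p. cmod (coord \<alpha> p)) * norm \<beta>"
      using norm_twisted_mult_le[OF summ, of 0 "ab \<beta>"] by (simp add: v_def norm_ab ab)
  qed
qed

text \<open>The phases have modulus one, and the weight can be moved onto one of the two factors.
  Then that factor enters through its weighted \<ell>2 norm and the other through its \<ell>1 norm.
  The constant collects the power of 4 from the weight inequality, 2 for the two terms, and the
  embedding constant.\<close>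

lemma torus_times_sobolev:
  fixes a b :: "('n::{finite,linorder}) torus_L2"
  assumes s: "s > real CARD('n) / 2" and a: "a \<in> sobolev \<theta> s" and b: "b \<in> sobolev \<theta> s"
  shows "torus_times \<theta> a b \<in> sobolev \<theta> s"
    and "sobolev_norm \<theta> s (torus_times \<theta> a b)
      \<le> 4 powr (s / 2) * (2 * sqrt (\<Sum>\<^sub>\<infinity>m::'n freq. sobolev_weight m powr (- s))) *
        sobolev_norm \<theta> s a * sobolev_norm \<theta> s b"
proof -
  let ?S = "sqrt (\<Sum>\<^sub>\<infinity>m::'n freq. sobolev_weight m powr (- s))"
  let ?w = "\<lambda>m. sobolev_weight m powr (s / 2)"
  note sa = sobolev_abs_summable[OF s a] and sb = sobolev_abs_summable[OF s b]
  obtain v r where r: "\<And>m. ((\<lambda>p. cmod (coord a p) * cmod (coord (sobolev_iso \<theta> s b) (m - p))) has_sum r m) UNIV"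
      and v: "\<And>m. coord v m = of_real (r m)" "\<And>m. r m \<ge> 0"
      "norm v \<le> (\<Sum>\<^sub>\<infinity>p. cmod (coord a p)) * norm (sobolev_iso \<theta> s b)"
    by (rule Young_convolution[OF sa(1), of "sobolev_iso \<theta> s b"]) (rule that)
  obtain v' r' where r': "\<And>m. ((\<lambda>p. cmod (coord b p) * cmod (coord (sobolev_iso \<theta> s a) (m - p))) has_sum r' m) UNIV"
      and v': "\<And>m. coord v' m = of_real (r' m)" "\<And>m. r' m \<ge> 0"
      "norm v' \<le> (\<Sum>\<^sub>\<infinity>p. cmod (coord b p)) * norm (sobolev_iso \<theta> s a)"
    by (rule Young_convolution[OF sb(1), of "sobolev_iso \<theta> s a"]) (rule that)
  have dom: "?w m * cmod (coord (torus_times \<theta> a b) m) \<le> 4 powr (s / 2) * cmod (coord (v + v') m)" for m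
  proof -
    \<comment> \<open>Young's inequality puts the \<ell>1 factor first. Here that factor is
      \<open>b\<close>, which stands second in the product, so the sum is reindexed by p to m -
      p.\<close>
    have flip: "((\<lambda>p. cmod (coord (sobolev_iso \<theta> s a) p) * cmod (coord b (m - p))) has_sum r' m) UNIV"
    proof -
      have "bij_betw (\<lambda>p. m - p) UNIV UNIV"
        by (rule bij_betw_byWitness[of _ "\<lambda>p. m - p"]) auto
      from has_sum_reindex_bij_betw[OF this, THEN iffD2, OF r'[of m]]
      show ?thesis by (simp add: mult.commute)
    qed
    let ?R = "\<lambda>p. 4 powr (s / 2) * (cmod (coord (sobolev_iso \<theta> s a) p) * cmod (coord b (m - p))
        + cmod (coord a p) * cmod (coord (sobolev_iso \<theta> s b) (m - p)))"
    have R: "(?R has_sum 4 powr (s / 2) * (r' m + r m)) UNIV"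
      by (rule has_sum_cmult_right[OF has_sum_add[OF flip r]])
    have prod: "((\<lambda>p. of_real (?w m) * (coord a p * cis (twist \<theta> p (m - p)) * coord b (m - p)))
        has_sum of_real (?w m) * coord (torus_times \<theta> a b) m) UNIV"
      using has_sum_cmult_right[OF has_sum_coord_twisted_mult[OF sa(1)]]
      by (simp add: torus_times_eq_twisted_mult sa sb)
    have le: "norm (of_real (?w m) * (coord a p * cis (twist \<theta> p (m - p)) * coord b (m - p))) \<le> ?R p" for p
    proof -
      have "norm (of_real (?w m) * (coord a p * cis (twist \<theta> p (m - p)) * coord b (m - p)))
          = ?w m * (cmod (coord a p) * cmod (coord b (m - p)))"
        by (simp add: norm_mult)
      also have "\<dots> \<le> (4 powr (s / 2) * (?w p + ?w (m - p))) * (cmod (coord a p) * cmod (coord b (m - p)))"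
        using s of_nat_0_le_iff[of "CARD('n)"]
        by (intro mult_right_mono sobolev_weight_powr_le) (auto simp del: of_nat_0_le_iff)
      also have "\<dots> = ?R p"
        by (simp add: cmod_coord_sobolev_iso a b algebra_simps)
      finally show ?thesis .
    qed
    have "norm (of_real (?w m) * coord (torus_times \<theta> a b) m) \<le> 4 powr (s / 2) * (r' m + r m)"
      by (rule norm_infsum_le[OF prod R]) (use le in auto)
    also have "r' m + r m = cmod (coord (v + v') m)"
    proof -
      have "coord (v + v') m = of_real (r' m + r m)"
        by (simp add: plus_ell2.rep_eq v(1) v'(1))
      then show ?thesis using v(2)[of m] v'(2)[of m] by (simp only: norm_of_real)
    qed
    finally show ?thesis by (simp add: norm_mult)
  qed
  show "torus_times \<theta> a b \<in> sobolev \<theta> s"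
    by (rule sobolev_dominatedI(1)[OF dom]) simp
  have "norm v \<le> ?S * sobolev_norm \<theta> s a * sobolev_norm \<theta> s b"
    using v(3) mult_right_mono[OF sa(2), of "sobolev_norm \<theta> s b"] by (simp add: norm_sobolev_iso b)
  moreover have "norm v' \<le> ?S * sobolev_norm \<theta> s b * sobolev_norm \<theta> s a"
    using v'(3) mult_right_mono[OF sb(2), of "sobolev_norm \<theta> s a"] by (simp add: norm_sobolev_iso a)
  ultimately have "norm (v + v') \<le> 2 * ?S * sobolev_norm \<theta> s a * sobolev_norm \<theta> s b"
    using norm_triangle_ineq[of v v'] by (simp add: mult_ac)
  then have "4 powr (s / 2) * norm (v + v') \<le> 4 powr (s / 2) * (2 * ?S * sobolev_norm \<theta> s a * sobolev_norm \<theta> s b)"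
    by (rule mult_left_mono) simp
  moreover have "sobolev_norm \<theta> s (torus_times \<theta> a b) \<le> 4 powr (s / 2) * norm (v + v')"
    by (rule sobolev_dominatedI(2)[OF dom]) simp
  ultimately show "sobolev_norm \<theta> s (torus_times \<theta> a b)
      \<le> 4 powr (s / 2) * (2 * ?S) * sobolev_norm \<theta> s a * sobolev_norm \<theta> s b"
    unfolding mult.assoc by (rule order_trans[rotated])
qed

section \<open>Families bounded in a Sobolev norm\<close>

definition sobolev_bounded ::
    "('n::{finite,linorder}) torus_matrix \<Rightarrow> real \<Rightarrow> 'i set \<Rightarrow> ('i \<Rightarrow> 'n torus_L2) \<Rightarrow> bool" where
  "sobolev_bounded \<theta> s I f \<longleftrightarrow> (\<exists>M. \<forall>t\<in>I. f t \<in> sobolev \<theta> s \<and> sobolev_norm \<theta> s (f t) \<le> M)"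

lemma sobolev_boundedE:
  assumes "sobolev_bounded \<theta> s I f"
  obtains M where "M \<ge> 0" "\<And>t. t \<in> I \<Longrightarrow> f t \<in> sobolev \<theta> s" "\<And>t. t \<in> I \<Longrightarrow> sobolev_norm \<theta> s (f t) \<le> M"
proof -
  obtain M where M: "\<forall>t\<in>I. f t \<in> sobolev \<theta> s \<and> sobolev_norm \<theta> s (f t) \<le> M"
    using assms by (auto simp: sobolev_bounded_def)
  \<comment> \<open>For an empty index set the given bound may be negative.\<close>
  show thesis by (rule that[of "max 0 M"]) (use M in \<open>auto intro: max.coboundedI2\<close>)
qed

lemma sobolev_bounded_const: "a \<in> sobolev \<theta> s \<Longrightarrow> sobolev_bounded \<theta> s I (\<lambda>_. a)"
  by (auto simp: sobolev_bounded_def)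

lemma sobolev_bounded_add:
  assumes "sobolev_bounded \<theta> s I f" "sobolev_bounded \<theta> s I g"
  shows "sobolev_bounded \<theta> s I (\<lambda>t. f t + g t)"
proof -
  obtain M where M: "M \<ge> 0" "\<And>t. t \<in> I \<Longrightarrow> f t \<in> sobolev \<theta> s" "\<And>t. t \<in> I \<Longrightarrow> sobolev_norm \<theta> s (f t) \<le> M"
    by (rule sobolev_boundedE[OF assms(1)]) (rule that)
  obtain M' where M': "M' \<ge> 0" "\<And>t. t \<in> I \<Longrightarrow> g t \<in> sobolev \<theta> s" "\<And>t. t \<in> I \<Longrightarrow> sobolev_norm \<theta> s (g t) \<le> M'"
    by (rule sobolev_boundedE[OF assms(2)]) (rule that)
  show ?thesis
    unfolding sobolev_bounded_def
  proof (intro exI[of _ "M + M'"] ballI conjI)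
    fix t assume t: "t \<in> I"
    show "f t + g t \<in> sobolev \<theta> s" using sobolev_add(1) M(2) M'(2) t by blast
    show "sobolev_norm \<theta> s (f t + g t) \<le> M + M'"
      using sobolev_add(2)[OF M(2)[OF t] M'(2)[OF t]] M(3)[OF t] M'(3)[OF t] by simp
  qed
qed

lemma sobolev_bounded_sum:
  assumes "\<And>i. i \<in> A \<Longrightarrow> sobolev_bounded \<theta> s I (f i)"
  shows "sobolev_bounded \<theta> s I (\<lambda>t. \<Sum>i\<in>A. f i t)"
  using assms
proof (induction A rule: infinite_finite_induct)
  case (insert i A)
  then show ?case by (simp add: sobolev_bounded_add)
qed (auto intro!: sobolev_bounded_const simp: mem_sobolev_iff zero_ell2.rep_eq)

lemma sobolev_bounded_torus_times:
  fixes f g :: "'i \<Rightarrow> ('n::{finite,linorder}) torus_L2"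
  assumes s: "s > real CARD('n) / 2" and "sobolev_bounded \<theta> s I f" "sobolev_bounded \<theta> s I g"
  shows "sobolev_bounded \<theta> s I (\<lambda>t. torus_times \<theta> (f t) (g t))"
proof -
  obtain M where M: "M \<ge> 0" "\<And>t. t \<in> I \<Longrightarrow> f t \<in> sobolev \<theta> s" "\<And>t. t \<in> I \<Longrightarrow> sobolev_norm \<theta> s (f t) \<le> M"
    by (rule sobolev_boundedE[OF assms(2)]) (rule that)
  obtain M' where M': "M' \<ge> 0" "\<And>t. t \<in> I \<Longrightarrow> g t \<in> sobolev \<theta> s" "\<And>t. t \<in> I \<Longrightarrow> sobolev_norm \<theta> s (g t) \<le> M'"
    by (rule sobolev_boundedE[OF assms(3)]) (rule that)
  define C where "C = 4 powr (s / 2) * (2 * sqrt (\<Sum>\<^sub>\<infinity>m::'n freq. sobolev_weight m powr (- s)))"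
  have C: "C \<ge> 0" by (simp add: C_def infsum_nonneg)
  show ?thesis
    unfolding sobolev_bounded_def
  proof (intro exI[of _ "C * M * M'"] ballI conjI)
    fix t assume t: "t \<in> I"
    note prod = torus_times_sobolev[OF s M(2)[OF t] M'(2)[OF t], folded C_def]
    show "torus_times \<theta> (f t) (g t) \<in> sobolev \<theta> s" by (rule prod)
    note prod(2)
    also have "C * sobolev_norm \<theta> s (f t) * sobolev_norm \<theta> s (g t) \<le> C * M * M'"
      using M M' C t by (intro mult_mono) auto
    finally show "sobolev_norm \<theta> s (torus_times \<theta> (f t) (g t)) \<le> C * M * M'" .
  qed
qed

lemma sobolev_bounded_nc_polynomial:
  fixes u :: "'i \<Rightarrow> ('n::{finite,linorder}) torus_L2"
  assumes s: "s > real CARD('n) / 2" and u: "sobolev_bounded \<theta> s I u"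
    and b: "\<And>\<nu> \<mu> j. \<nu> \<le> q \<Longrightarrow> \<mu> \<in> {1..N \<nu>} \<Longrightarrow> j \<le> \<nu> \<Longrightarrow> b \<nu> \<mu> j \<in> sobolev \<theta> s"
  shows "sobolev_bounded \<theta> s I (\<lambda>t. nc_polynomial \<theta> q N b (u t))"
proof -
  have "sobolev_bounded \<theta> s I (\<lambda>t. nc_monomial \<theta> c \<nu> (u t))"
    if "\<And>j. j \<le> \<nu> \<Longrightarrow> c j \<in> sobolev \<theta> s" for c \<nu>
    using that
  proof (induction \<nu>)
    case 0
    then show ?case by (simp add: sobolev_bounded_const)
  next
    case (Suc \<nu>)
    then have "sobolev_bounded \<theta> s I (\<lambda>t. nc_monomial \<theta> c \<nu> (u t))" by simp
    from sobolev_bounded_torus_times[OF s sobolev_bounded_torus_times[OF s this u]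
        sobolev_bounded_const[OF Suc.prems[of "Suc \<nu>"]]]
    show ?case by simp
  qed
  then show ?thesis
    unfolding nc_polynomial_def using b by (intro sobolev_bounded_sum) auto
qed

section \<open>Parabolic smoothing\<close>

text \<open>The integral of (c f + g)^2 is a quadratic polynomial in c without negative values. Its
  minimum, at c = -B/A, gives the claim; A = 0 is separate, as f may vanish almost
  everywhere.\<close>

lemma integral_Cauchy_Schwarz:
  fixes f g :: "real \<Rightarrow> real"
  assumes "(\<lambda>x. (f x)\<^sup>2) integrable_on S" "(\<lambda>x. (g x)\<^sup>2) integrable_on S" "(\<lambda>x. f x * g x) integrable_on S"
  shows "(integral S (\<lambda>x. f x * g x))\<^sup>2 \<le> integral S (\<lambda>x. (f x)\<^sup>2) * integral S (\<lambda>x. (g x)\<^sup>2)"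
proof -
  define A B C where "A = integral S (\<lambda>x. (f x)\<^sup>2)" and "B = integral S (\<lambda>x. f x * g x)"
    and "C = integral S (\<lambda>x. (g x)\<^sup>2)"
  have quad: "0 \<le> c\<^sup>2 * A + 2 * c * B + C" for c
  proof -
    have "((\<lambda>x. c\<^sup>2 * (f x)\<^sup>2 + 2 * c * (f x * g x) + (g x)\<^sup>2) has_integral c\<^sup>2 * A + 2 * c * B + C) S"
      unfolding A_def B_def C_def
      by (intro has_integral_add has_integral_mult_right integrable_integral assms)
    moreover have "0 \<le> c\<^sup>2 * (f x)\<^sup>2 + 2 * c * (f x * g x) + (g x)\<^sup>2" for x
      using zero_le_power2[of "c * f x + g x"] by (simp add: power2_eq_square algebra_simps)
    ultimately show ?thesis by (meson has_integral_nonneg)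
  qed
  have A: "A \<ge> 0" unfolding A_def by (rule integral_nonneg) (use assms in auto)
  have "B\<^sup>2 \<le> A * C"
  proof (cases "A = 0")
    case True
    have "B = 0"
    proof (rule ccontr)
      assume "B \<noteq> 0"
      \<comment> \<open>With A = 0 the polynomial is linear in c; this c is where it takes the value
        -1.\<close>
      then have "2 * (- (C + 1) / (2 * B)) * B + C = - 1" by (simp add: field_simps)
      then show False using quad[of "- (C + 1) / (2 * B)"] True by simp
    qed
    then show ?thesis using True by simp
  next
    case False
    have "0 \<le> A * ((- B / A)\<^sup>2 * A + 2 * (- B / A) * B + C)"
      by (rule mult_nonneg_nonneg[OF A quad])
    also have "\<dots> = A * C - B\<^sup>2"
      using False by (simp add: power2_eq_square field_simps)
    finally show ?thesis by simp
  qed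
  then show ?thesis by (simp add: A_def B_def C_def)
qed

lemma has_bochner_integral_imp_has_integral:
  fixes f :: "'a::euclidean_space \<Rightarrow> 'b::euclidean_space"
  assumes "has_bochner_integral (lebesgue_on S) f x" "S \<in> sets lebesgue"
  shows "(f has_integral x) S"
  using has_integral_integral_lebesgue_on[of S f] assms by (auto simp: has_bochner_integral_iff)

section \<open>Duhamel's formula for single Fourier coefficients\<close>

lemma coord_heat:
  fixes a :: "('n::{finite,linorder}) torus_L2"
  assumes "t \<ge> 0"
  shows "coord (heat \<theta> t a) m = of_real (exp (- (4 * pi\<^sup>2 * freq_sq m) * t)) * coord a m"
proof -
  have "(\<lambda>m. (cmod (of_real (exp (- 4 * pi\<^sup>2 * freq_sq m * t)) * coord a m))\<^sup>2) summable_on UNIV"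
  proof (rule summable_on_comparison_test[OF coord_square_summable[of a]])
    fix m :: "'n freq"
    have "exp (- 4 * pi\<^sup>2 * freq_sq m * t) \<le> 1"
      using assms freq_sq_nonneg[of m] by simp
    then have "exp (- 4 * pi\<^sup>2 * freq_sq m * t) * cmod (coord a m) \<le> 1 * cmod (coord a m)"
      by (intro mult_right_mono) auto
    then show "(cmod (of_real (exp (- 4 * pi\<^sup>2 * freq_sq m * t)) * coord a m))\<^sup>2 \<le> (cmod (coord a m))\<^sup>2"
      by (intro power_mono) (auto simp: norm_mult)
  qed auto
  then show ?thesis
    using fourier_fourier_mult[of "\<lambda>m. exp (- 4 * pi\<^sup>2 * freq_sq m * t)" \<theta> a m]
    by (simp add: heat_def fourier_eq_coord)
qed

text \<open>A coordinate is a bounded functional, so it passes through the Bochner integral of the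
  images under \<open>sobolev_iso\<close>. Dividing by the nonzero weight leaves a scalar formula
  free of the Sobolev index.\<close>

lemma mild_solution_coord:
  assumes u: "mild_solution \<theta> s P u0 T u" and t: "0 \<le> t" "t \<le> T"
  shows "((\<lambda>r. of_real (exp (- (4 * pi\<^sup>2 * freq_sq m) * (t - r))) * coord (P (u r)) m) has_integral
      (coord (u t) m - of_real (exp (- (4 * pi\<^sup>2 * freq_sq m) * t)) * coord u0 m)) {0..t}"
proof -
  obtain x where int: "has_sobolev_integral \<theta> s {0..t} (\<lambda>r. heat \<theta> (t - r) (P (u r))) x"
    and ut: "u t = heat \<theta> t u0 + x"
    using u t unfolding mild_solution_def by (meson atLeastAtMost_iff)
  let ?F = "\<lambda>r. of_real (exp (- (4 * pi\<^sup>2 * freq_sq m) * (t - r))) * coord (P (u r)) m"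
  let ?w = "sobolev_weight m powr (s / 2)"
  have w: "?w \<noteq> 0" using sobolev_weight_pos[of m] by simp
  have mem: "\<And>r. r \<in> {0..t} \<Longrightarrow> heat \<theta> (t - r) (P (u r)) \<in> sobolev \<theta> s" "x \<in> sobolev \<theta> s"
    and hb: "has_bochner_integral (lebesgue_on {0..t})
      (\<lambda>r. sobolev_iso \<theta> s (heat \<theta> (t - r) (P (u r)))) (sobolev_iso \<theta> s x)"
    using int by (simp_all add: has_sobolev_integral_def)
  have "has_bochner_integral (lebesgue_on {0..t})
      (\<lambda>r. coord (sobolev_iso \<theta> s (heat \<theta> (t - r) (P (u r)))) m) (coord (sobolev_iso \<theta> s x) m)"
    by (rule has_bochner_integral_bounded_linear[OF bounded_linear_coord hb])
  then have "has_bochner_integral (lebesgue_on {0..t}) (\<lambda>r. of_real ?w * ?F r) (of_real ?w * coord x m)"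
    by (rule has_bochner_integral_cong[THEN iffD1, rotated -1])
      (auto simp: coord_sobolev_iso[OF mem(1)] coord_sobolev_iso[OF mem(2)] coord_heat)
  then have "((\<lambda>r. of_real ?w * ?F r) has_integral of_real ?w * coord x m) {0..t}"
    by (rule has_bochner_integral_imp_has_integral) simp
  from has_integral_mult_right[OF this, of "inverse (of_real ?w)"]
  have "(?F has_integral coord x m) {0..t}"
    using w by (simp add: mult.assoc[symmetric])
  moreover have "coord x m = coord (u t) m - of_real (exp (- (4 * pi\<^sup>2 * freq_sq m) * t)) * coord u0 m"
    using coord_heat[OF t(1), of \<theta> u0 m] by (simp add: ut plus_ell2.rep_eq)
  ultimately show ?thesis by simp
qed

text \<open>The semigroup law in scalar form: the formula at time \<epsilon>, multiplied by
  e^{-l(t-\<epsilon>)}, is subtracted from the formula at time t, which cancels the initial datum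
  and the integral up to \<epsilon>.\<close>

lemma mild_solution_coord_restart:
  assumes u: "mild_solution \<theta> s P u0 T u" and t: "0 \<le> \<epsilon>" "\<epsilon> \<le> t" "t \<le> T"
  shows "((\<lambda>r. of_real (exp (- (4 * pi\<^sup>2 * freq_sq m) * (t - r))) * coord (P (u r)) m) has_integral
      (coord (u t) m - of_real (exp (- (4 * pi\<^sup>2 * freq_sq m) * (t - \<epsilon>))) * coord (u \<epsilon>) m)) {\<epsilon>..t}"
proof -
  define l where "l = 4 * pi\<^sup>2 * freq_sq m"
  let ?F = "\<lambda>t r. of_real (exp (- l * (t - r))) * coord (P (u r)) m"
  let ?e = "complex_of_real (exp (- l * (t - \<epsilon>)))"
  have e: "?e * of_real (exp (- l * (\<epsilon> - r))) = of_real (exp (- l * (t - r)))" for r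
    by (simp add: exp_add[symmetric] algebra_simps flip: of_real_mult)
  have F\<epsilon>: "(?F \<epsilon> has_integral coord (u \<epsilon>) m - of_real (exp (- l * \<epsilon>)) * coord u0 m) {0..\<epsilon>}"
    unfolding l_def by (rule mild_solution_coord[OF u]) (use t in auto)
  have Ft: "(?F t has_integral coord (u t) m - of_real (exp (- l * t)) * coord u0 m) {0..t}"
    unfolding l_def by (rule mild_solution_coord[OF u]) (use t in auto)
  have "((\<lambda>r. ?e * ?F \<epsilon> r) has_integral ?e * (coord (u \<epsilon>) m - of_real (exp (- l * \<epsilon>)) * coord u0 m)) {0..\<epsilon>}"
    by (rule has_integral_mult_right[OF F\<epsilon>])
  moreover have "?e * ?F \<epsilon> r = ?F t r" for r
    unfolding mult.assoc[symmetric] e ..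
  moreover have "?e * (coord (u \<epsilon>) m - of_real (exp (- l * \<epsilon>)) * coord u0 m)
      = ?e * coord (u \<epsilon>) m - of_real (exp (- l * t)) * coord u0 m"
    using e[of 0] by (simp add: right_diff_distrib mult.assoc[symmetric] del: of_real_exp)
  ultimately have F1: "integral {0..\<epsilon>} (?F t) = ?e * coord (u \<epsilon>) m - of_real (exp (- l * t)) * coord u0 m"
    by (simp only: integral_unique)
  have int: "?F t integrable_on {0..t}" using Ft by blast
  then have "?F t integrable_on {\<epsilon>..t}"
    by (rule integrable_subinterval_real) (use t in auto)
  moreover have "integral {\<epsilon>..t} (?F t) = coord (u t) m - ?e * coord (u \<epsilon>) m"
  proof -
    have "integral {\<epsilon>..t} (?F t) = integral {0..t} (?F t) - integral {0..\<epsilon>} (?F t)"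
      unfolding Henstock_Kurzweil_Integration.integral_combine[OF t(1,2) int, symmetric]
      by (rule add_diff_cancel_left'[symmetric])
    then show ?thesis unfolding F1 integral_unique[OF Ft] by simp
  qed
  ultimately have "(?F t has_integral coord (u t) m - ?e * coord (u \<epsilon>) m) {\<epsilon>..t}"
    using integrable_integral[of "?F t" "{\<epsilon>..t}"] by (simp only:)
  then show ?thesis unfolding l_def .
qed

text \<open>The integrand is at most 1, which bounds the integral by t - \<epsilon>. Its derivative
  is 2l times itself, which bounds 2l times the integral by 1. Adding the two makes the estimate
  uniform down to l = 0.\<close>

lemma exp_square_integral_le:
  fixes l \<epsilon> t :: real
  assumes "l \<ge> 0" "\<epsilon> \<le> t"
  shows "(\<lambda>r. (exp (- l * (t - r)))\<^sup>2) integrable_on {\<epsilon>..t}"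
    and "(1 + l) * integral {\<epsilon>..t} (\<lambda>r. (exp (- l * (t - r)))\<^sup>2) \<le> t - \<epsilon> + 1"
proof -
  let ?e = "\<lambda>r. (exp (- l * (t - r)))\<^sup>2"
  show int: "?e integrable_on {\<epsilon>..t}"
    by (intro integrable_continuous_interval continuous_intros)
  have "integral {\<epsilon>..t} ?e \<le> integral {\<epsilon>..t} (\<lambda>_. 1)"
    using assms by (intro integral_le int) (auto simp: power_le_one)
  then have 1: "integral {\<epsilon>..t} ?e \<le> t - \<epsilon>" using assms by simp
  have "((\<lambda>r. 2 * l * ?e r) has_integral (?e t - ?e \<epsilon>)) {\<epsilon>..t}"
  proof (rule fundamental_theorem_of_calculus[OF assms(2)])
    fix r
    have "(?e has_real_derivative 2 * l * ?e r) (at r within {\<epsilon>..t})"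
      by (auto intro!: derivative_eq_intros simp: power2_eq_square)
    then show "(?e has_vector_derivative 2 * l * ?e r) (at r within {\<epsilon>..t})"
      by (simp add: has_real_derivative_iff_has_vector_derivative)
  qed
  moreover have "((\<lambda>r. 2 * l * ?e r) has_integral 2 * l * integral {\<epsilon>..t} ?e) {\<epsilon>..t}"
    by (intro has_integral_mult_right integrable_integral int)
  ultimately have "2 * l * integral {\<epsilon>..t} ?e = ?e t - ?e \<epsilon>"
    by (rule has_integral_unique[rotated])
  also have "\<dots> \<le> 1" by simp
  finally have "2 * l * integral {\<epsilon>..t} ?e \<le> 1" .
  with 1 show "(1 + l) * integral {\<epsilon>..t} ?e \<le> t - \<epsilon> + 1" by (simp add: algebra_simps)
qed

text \<open>Cauchy-Schwarz in time gains the factor \<open>1 + l\<close>, that is, one derivative.\<close>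

lemma mild_solution_coord_bound:
  assumes u: "mild_solution \<theta> s0 P u0 T u" and t: "0 \<le> \<epsilon>" "\<epsilon> + \<delta> \<le> t" "t \<le> T" and \<delta>: "\<delta> > 0"
    and bdd: "\<And>r. r \<in> {\<epsilon>..t} \<Longrightarrow> cmod (coord (P (u r)) m) \<le> M"
  shows "(\<lambda>r. (cmod (coord (P (u r)) m))\<^sup>2) integrable_on {\<epsilon>..t}"
    and "sobolev_weight m * (cmod (coord (u t) m))\<^sup>2 \<le> 2 * (1 + 1 / \<delta>) * (cmod (coord (u \<epsilon>) m))\<^sup>2
      + 2 * (T + 1) * integral {\<epsilon>..t} (\<lambda>r. (cmod (coord (P (u r)) m))\<^sup>2)"
proof -
  define l where "l = 4 * pi\<^sup>2 * freq_sq m"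
  have l: "l \<ge> 0" by (simp add: l_def freq_sq_nonneg)
  have w: "sobolev_weight m = 1 + l" by (simp add: sobolev_weight_def l_def)
  have \<epsilon>t: "\<epsilon> \<le> t" using t \<delta> by simp
  let ?g = "\<lambda>r. coord (P (u r)) m"
  let ?F = "\<lambda>r. of_real (exp (- l * (t - r))) * ?g r"
  let ?x = "coord (u t) m - of_real (exp (- l * (t - \<epsilon>))) * coord (u \<epsilon>) m"
  have F: "(?F has_integral ?x) {\<epsilon>..t}"
    unfolding l_def by (rule mild_solution_coord_restart[OF u t(1) \<epsilon>t t(3)])
  have Fm: "?F \<in> borel_measurable (lebesgue_on {\<epsilon>..t})"
    using F by (intro integrable_imp_measurable) blast
  \<comment> \<open>Measurability of the coefficient of the nonlinearity is recovered from the
    Duhamel integrand by multiplying with the inverse of the kernel, which is continuous.\<close>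
  have "(\<lambda>r. of_real (exp (l * (t - r))) * ?F r) \<in> borel_measurable (lebesgue_on {\<epsilon>..t})"
    by (intro borel_measurable_times Fm continuous_imp_measurable_on_sets_lebesgue continuous_intros) auto
  moreover have "of_real (exp (l * (t - r))) * ?F r = ?g r" for r
    by (simp add: mult.assoc[symmetric] exp_minus flip: of_real_mult)
  ultimately have gm: "?g \<in> borel_measurable (lebesgue_on {\<epsilon>..t})" by (simp only:)
  have bounded_integrable: "f integrable_on {\<epsilon>..t}"
    if "f \<in> borel_measurable (lebesgue_on {\<epsilon>..t})" "\<And>r. r \<in> {\<epsilon>..t} \<Longrightarrow> \<bar>f r\<bar> \<le> c" for f :: "real \<Rightarrow> real" and c
    using measurable_bounded_by_integrable_imp_absolutely_integrable[OF that(1), of "\<lambda>_. c"] that(2)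
    by (auto simp: absolutely_integrable_on_def integrable_const_ivl)
  show g2: "(\<lambda>r. (cmod (?g r))\<^sup>2) integrable_on {\<epsilon>..t}"
  proof (rule bounded_integrable)
    show "(\<lambda>r. (cmod (?g r))\<^sup>2) \<in> borel_measurable (lebesgue_on {\<epsilon>..t})" using gm by measurable
    show "\<bar>(cmod (?g r))\<^sup>2\<bar> \<le> M\<^sup>2" if "r \<in> {\<epsilon>..t}" for r using bdd[OF that] by (simp add: power_mono)
  qed
  have nF: "(\<lambda>r. exp (- l * (t - r)) * cmod (?g r)) integrable_on {\<epsilon>..t}"
  proof (rule bounded_integrable)
    have "(\<lambda>r. cmod (?F r)) \<in> borel_measurable (lebesgue_on {\<epsilon>..t})" using Fm by measurable
    then show "(\<lambda>r. exp (- l * (t - r)) * cmod (?g r)) \<in> borel_measurable (lebesgue_on {\<epsilon>..t})"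
      by (simp add: norm_mult)
    show "\<bar>exp (- l * (t - r)) * cmod (?g r)\<bar> \<le> 1 * M" if "r \<in> {\<epsilon>..t}" for r
      unfolding abs_mult using bdd[OF that] that l by (intro mult_mono) auto
  qed
  let ?E = "integral {\<epsilon>..t} (\<lambda>r. (exp (- l * (t - r)))\<^sup>2)"
  let ?G = "integral {\<epsilon>..t} (\<lambda>r. (cmod (?g r))\<^sup>2)"
  have G: "?G \<ge> 0" by (rule integral_nonneg[OF g2]) simp
  have "cmod ?x \<le> integral {\<epsilon>..t} (\<lambda>r. exp (- l * (t - r)) * cmod (?g r))"
    unfolding integral_unique[OF F, symmetric]
    using F by (intro integral_norm_bound_integral nF) (auto simp: norm_mult)
  then have "(cmod ?x)\<^sup>2 \<le> (integral {\<epsilon>..t} (\<lambda>r. exp (- l * (t - r)) * cmod (?g r)))\<^sup>2"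
    by (intro power_mono) auto
  also have "\<dots> \<le> ?E * ?G"
    by (rule integral_Cauchy_Schwarz[OF exp_square_integral_le(1)[OF l \<epsilon>t] g2 nF])
  finally have "(1 + l) * (cmod ?x)\<^sup>2 \<le> (1 + l) * (?E * ?G)"
    using l by (intro mult_left_mono) auto
  also have "\<dots> \<le> (T + 1) * ?G"
    unfolding mult.assoc[symmetric] using exp_square_integral_le(2)[OF l \<epsilon>t] t G
    by (intro mult_right_mono) auto
  finally have x: "(1 + l) * (cmod ?x)\<^sup>2 \<le> (T + 1) * ?G" .
  let ?y = "of_real (exp (- l * (t - \<epsilon>))) * coord (u \<epsilon>) m"
  \<comment> \<open>Smoothing of the homogeneous part: since t - \<epsilon> \<ge> \<delta>, the
    squared exponential is at most e^{-l\<delta>}, and 1 + l \<le> (1 + 1/\<delta>) e^{l\<delta>}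
    because both 1 and l\<delta> are at most e^{l\<delta>}.\<close>
  have e: "(1 + l) * (exp (- l * (t - \<epsilon>)))\<^sup>2 \<le> 1 + 1 / \<delta>"
  proof -
    have "exp (- l * (t - \<epsilon>)) \<le> exp (- (l * \<delta>))"
      using t l by (simp add: mult_left_mono)
    moreover have "(exp (- l * (t - \<epsilon>)))\<^sup>2 \<le> exp (- l * (t - \<epsilon>))"
      using l \<epsilon>t by (simp add: power2_eq_square mult_le_cancel_left1)
    ultimately have "(exp (- l * (t - \<epsilon>)))\<^sup>2 \<le> exp (- (l * \<delta>))" by linarith
    then have "(1 + l) * (exp (- l * (t - \<epsilon>)))\<^sup>2 \<le> (1 + l) * exp (- (l * \<delta>))"
      using l by (intro mult_left_mono) auto
    also have "\<dots> \<le> 1 + 1 / \<delta>"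
    proof -
      have "l * \<delta> \<le> exp (l * \<delta>)" using exp_ge_add_one_self[of "l * \<delta>"] by linarith
      then have "1 + l \<le> (1 + 1 / \<delta>) * exp (l * \<delta>)"
      proof -
        have "(1 / \<delta>) * (l * \<delta>) \<le> (1 / \<delta>) * exp (l * \<delta>)"
          using \<open>l * \<delta> \<le> exp (l * \<delta>)\<close> \<delta> by (intro mult_left_mono) auto
        then have "l \<le> (1 / \<delta>) * exp (l * \<delta>)" using \<delta> by simp
        moreover have "1 \<le> exp (l * \<delta>)" using l \<delta> by simp
        ultimately show ?thesis unfolding distrib_right by linarith
      qed
      then show ?thesis by (simp add: exp_minus field_simps)
    qed
    finally show ?thesis .
  qed
  have y: "(1 + l) * (cmod ?y)\<^sup>2 \<le> (1 + 1 / \<delta>) * (cmod (coord (u \<epsilon>) m))\<^sup>2"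
    using mult_right_mono[OF e, of "(cmod (coord (u \<epsilon>) m))\<^sup>2"]
    by (simp add: norm_mult power_mult_distrib mult.assoc)
  have "(cmod (coord (u t) m))\<^sup>2 \<le> 2 * (cmod ?x)\<^sup>2 + 2 * (cmod ?y)\<^sup>2"
  proof -
    have "cmod (coord (u t) m) \<le> cmod ?x + cmod ?y" using norm_triangle_ineq[of ?x ?y] by simp
    then have "(cmod (coord (u t) m))\<^sup>2 \<le> (cmod ?x + cmod ?y)\<^sup>2" by (intro power_mono) auto
    then show ?thesis using sum_squares_bound[of "cmod ?x" "cmod ?y"] by (simp add: power2_sum)
  qed
  then have "(1 + l) * (cmod (coord (u t) m))\<^sup>2 \<le> (1 + l) * (2 * (cmod ?x)\<^sup>2 + 2 * (cmod ?y)\<^sup>2)"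
    using l by (intro mult_left_mono) auto
  also have "\<dots> = 2 * ((1 + l) * (cmod ?x)\<^sup>2) + 2 * ((1 + l) * (cmod ?y)\<^sup>2)"
    by (simp only: distrib_left mult.left_commute)
  also have "\<dots> \<le> 2 * ((T + 1) * ?G) + 2 * ((1 + 1 / \<delta>) * (cmod (coord (u \<epsilon>) m))\<^sup>2)"
    using x y by linarith
  finally show "sobolev_weight m * (cmod (coord (u t) m))\<^sup>2 \<le> 2 * (1 + 1 / \<delta>) * (cmod (coord (u \<epsilon>) m))\<^sup>2
      + 2 * (T + 1) * ?G"
    unfolding w mult.assoc by linarith
qed

text \<open>The coefficient bound already contains the extra factor \<open>sobolev_weight m\<close>.
  Multiplying it by the weight of exponent s and summing over finitely many frequencies brings the
  sum inside the integral, where the H^s bound on the nonlinearity applies at each time.\<close>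

lemma sobolev_bounded_smoothing:
  assumes u: "mild_solution \<theta> s0 P u0 T u" and \<epsilon>: "0 \<le> \<epsilon>" and \<delta>: "\<delta> > 0"
    and ub: "sobolev_bounded \<theta> s {\<epsilon>..T} u" and Pb: "sobolev_bounded \<theta> s {\<epsilon>..T} (\<lambda>t. P (u t))"
  shows "sobolev_bounded \<theta> (s + 1) {\<epsilon> + \<delta>..T} u"
proof -
  obtain M where M: "M \<ge> 0" "\<And>t. t \<in> {\<epsilon>..T} \<Longrightarrow> P (u t) \<in> sobolev \<theta> s"
      "\<And>t. t \<in> {\<epsilon>..T} \<Longrightarrow> sobolev_norm \<theta> s (P (u t)) \<le> M"
    by (rule sobolev_boundedE[OF Pb]) (rule that)
  obtain K where K: "K \<ge> 0" "\<And>t. t \<in> {\<epsilon>..T} \<Longrightarrow> u t \<in> sobolev \<theta> s"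
      "\<And>t. t \<in> {\<epsilon>..T} \<Longrightarrow> sobolev_norm \<theta> s (u t) \<le> K"
    by (rule sobolev_boundedE[OF ub]) (rule that)
  let ?w = "\<lambda>m. sobolev_weight m powr s"
  \<comment> \<open>The first term comes from the solution at the restart time, the second from
    integrating M^2 over an interval of length at most T.\<close>
  define B where "B = 2 * (1 + 1 / \<delta>) * K\<^sup>2 + 2 * (T + 1) * (T * M\<^sup>2)"
  have "u t \<in> sobolev \<theta> (s + 1) \<and> (sobolev_norm \<theta> (s + 1) (u t))\<^sup>2 \<le> B" if t: "t \<in> {\<epsilon> + \<delta>..T}" for t
  proof -
    have \<epsilon>T: "\<epsilon> \<in> {\<epsilon>..T}" and T: "T \<ge> 0" and tT: "t \<le> T" and \<epsilon>t: "\<epsilon> \<le> t" and t': "\<epsilon> + \<delta> \<le> t"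
      using t \<epsilon> \<delta> by auto
    have sub: "r \<in> {\<epsilon>..T}" if "r \<in> {\<epsilon>..t}" for r using that tT by auto
    have sum: "(\<Sum>m\<in>F. sobolev_weight m powr (s + 1) * (cmod (coord (u t) m))\<^sup>2) \<le> B" if F: "finite F" for F
    proof -
      let ?g = "\<lambda>m r. (cmod (coord (P (u r)) m))\<^sup>2"
      have g: "sum (\<lambda>m. ?w m * ?g m r) F' \<le> M\<^sup>2" if "r \<in> {\<epsilon>..t}" "finite F'" for r F'
      proof -
        have "sum (\<lambda>m. ?w m * ?g m r) F' \<le> (sobolev_norm \<theta> s (P (u r)))\<^sup>2"
          by (rule sum_le_sobolev_norm[OF M(2)[OF sub[OF that(1)]] that(2)])
        also have "\<dots> \<le> M\<^sup>2" by (intro power_mono M(3) sub that(1)) simp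
        finally show ?thesis .
      qed
      \<comment> \<open>This bound may depend on m: it serves the integrability in
        \<open>mild_solution_coord_bound\<close> and does not enter the resulting estimate.\<close>
      have bdd: "cmod (coord (P (u r)) m) \<le> sqrt (M\<^sup>2 / ?w m)" if "r \<in> {\<epsilon>..t}" for r m
        using g[OF that, of "{m}"] sobolev_weight_pos[of m]
        by (intro real_le_rsqrt) (simp add: pos_le_divide_eq mult.commute)
      note est = mild_solution_coord_bound[OF u \<epsilon> t' tT \<delta> bdd]
      have "(\<Sum>m\<in>F. sobolev_weight m powr (s + 1) * (cmod (coord (u t) m))\<^sup>2)
          \<le> (\<Sum>m\<in>F. ?w m * (2 * (1 + 1 / \<delta>) * (cmod (coord (u \<epsilon>) m))\<^sup>2
            + 2 * (T + 1) * integral {\<epsilon>..t} (?g m)))"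
      proof (rule sum_mono)
        fix m
        have "sobolev_weight m powr (s + 1) * (cmod (coord (u t) m))\<^sup>2
            = ?w m * (sobolev_weight m * (cmod (coord (u t) m))\<^sup>2)"
          using sobolev_weight_pos[of m] by (simp add: powr_add)
        also have "\<dots> \<le> ?w m * (2 * (1 + 1 / \<delta>) * (cmod (coord (u \<epsilon>) m))\<^sup>2
            + 2 * (T + 1) * integral {\<epsilon>..t} (?g m))"
          by (intro mult_left_mono est(2)) auto
        finally show "sobolev_weight m powr (s + 1) * (cmod (coord (u t) m))\<^sup>2 \<le> \<dots>" .
      qed
      also have "\<dots> = 2 * (1 + 1 / \<delta>) * (\<Sum>m\<in>F. ?w m * (cmod (coord (u \<epsilon>) m))\<^sup>2)
          + 2 * (T + 1) * (\<Sum>m\<in>F. ?w m * integral {\<epsilon>..t} (?g m))"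
        unfolding sum_distrib_left sum.distrib[symmetric]
        by (intro sum.cong refl) (simp add: algebra_simps)
      also have "(\<Sum>m\<in>F. ?w m * integral {\<epsilon>..t} (?g m)) = integral {\<epsilon>..t} (\<lambda>r. \<Sum>m\<in>F. ?w m * ?g m r)"
        using F est(1) by (simp add: integral_sum integrable_on_mult_right)
      also have "2 * (1 + 1 / \<delta>) * (\<Sum>m\<in>F. ?w m * (cmod (coord (u \<epsilon>) m))\<^sup>2)
          + 2 * (T + 1) * integral {\<epsilon>..t} (\<lambda>r. \<Sum>m\<in>F. ?w m * ?g m r) \<le> B"
        unfolding B_def
      proof (intro add_mono mult_left_mono)
        have "(\<Sum>m\<in>F. ?w m * (cmod (coord (u \<epsilon>) m))\<^sup>2) \<le> (sobolev_norm \<theta> s (u \<epsilon>))\<^sup>2"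
          by (rule sum_le_sobolev_norm[OF K(2)[OF \<epsilon>T] F])
        also have "\<dots> \<le> K\<^sup>2" by (intro power_mono K(3) \<epsilon>T) simp
        finally show "(\<Sum>m\<in>F. ?w m * (cmod (coord (u \<epsilon>) m))\<^sup>2) \<le> K\<^sup>2" .
        have "integral {\<epsilon>..t} (\<lambda>r. \<Sum>m\<in>F. ?w m * ?g m r) \<le> integral {\<epsilon>..t} (\<lambda>_. M\<^sup>2)"
          using F est(1) g by (intro integral_le integrable_sum integrable_on_mult_right) auto
        also have "\<dots> = (t - \<epsilon>) * M\<^sup>2" using \<epsilon>t by simp
        also have "\<dots> \<le> T * M\<^sup>2" using tT \<epsilon> by (intro mult_right_mono) auto
        finally show "integral {\<epsilon>..t} (\<lambda>r. \<Sum>m\<in>F. ?w m * ?g m r) \<le> T * M\<^sup>2" .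
      qed (use \<delta> T in auto)
      finally show ?thesis .
    qed
    from sobolev_finite_sumsI[OF sum, where \<theta> = \<theta>] show ?thesis by blast
  qed
  then show ?thesis
    unfolding sobolev_bounded_def
    by (intro exI[of _ "sqrt B"] ballI) (auto intro: real_le_rsqrt)
qed

section \<open>From continuity to boundedness and back\<close>

lemma sobolev_continuous_on_imp_bounded:
  assumes u: "sobolev_continuous_on \<theta> s I u" and I: "compact I"
  shows "sobolev_bounded \<theta> s I u"
proof -
  have mem: "u t \<in> sobolev \<theta> s" if "t \<in> I" for t
    using u that by (simp add: sobolev_continuous_on_def)
  \<comment> \<open>Along this isometry continuity in H^s becomes ordinary continuity of an
    \<ell>2-valued function, and compactness can be used.\<close>
  have dist: "dist (sobolev_iso \<theta> s (u r)) (sobolev_iso \<theta> s (u t)) = sobolev_norm \<theta> s (u r - u t)"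
    if "r \<in> I" "t \<in> I" for r t
  proof -
    have "sobolev_iso \<theta> s (u r) - sobolev_iso \<theta> s (u t) = sobolev_iso \<theta> s (u r - u t)"
      by (rule ell2_eqI)
        (simp add: minus_ell2.rep_eq coord_sobolev_iso mem that sobolev_diff(1) right_diff_distrib)
    then show ?thesis
      by (simp add: dist_norm norm_sobolev_iso mem that sobolev_diff(1))
  qed
  have "continuous_on I (\<lambda>t. sobolev_iso \<theta> s (u t))"
    unfolding continuous_on_def
  proof
    fix t assume t: "t \<in> I"
    have "((\<lambda>r. dist (sobolev_iso \<theta> s (u r)) (sobolev_iso \<theta> s (u t))) \<longlongrightarrow> 0) (at t within I)"
    proof (rule Lim_transform_eventually)
      show "((\<lambda>r. sobolev_norm \<theta> s (u r - u t)) \<longlongrightarrow> 0) (at t within I)"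
        using u t by (simp add: sobolev_continuous_on_def)
      show "\<forall>\<^sub>F r in at t within I. sobolev_norm \<theta> s (u r - u t)
          = dist (sobolev_iso \<theta> s (u r)) (sobolev_iso \<theta> s (u t))"
        using t by (auto simp: eventually_at_filter dist)
    qed
    then show "((\<lambda>r. sobolev_iso \<theta> s (u r)) \<longlongrightarrow> sobolev_iso \<theta> s (u t)) (at t within I)"
      using tendsto_dist_iff by blast
  qed
  then have "bounded ((\<lambda>t. sobolev_iso \<theta> s (u t)) ` I)"
    using I compact_continuous_image compact_imp_bounded by blast
  then obtain M where "\<And>t. t \<in> I \<Longrightarrow> norm (sobolev_iso \<theta> s (u t)) \<le> M"
    by (auto simp: bounded_iff)
  then show ?thesis
    unfolding sobolev_bounded_def using mem by (intro exI[of _ M]) (auto simp: norm_sobolev_iso)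
qed

lemma sobolev_continuous_on_interpolation:
  assumes u: "sobolev_continuous_on \<theta> s {0..T} u" and r: "r \<ge> 0"
    and bdd: "\<And>\<epsilon>. \<epsilon> > 0 \<Longrightarrow> sobolev_bounded \<theta> (s + 2 * r) {\<epsilon>..T} u"
  shows "sobolev_continuous_on \<theta> (s + r) {0<..T} u"
  unfolding sobolev_continuous_on_def
proof (intro conjI ballI)
  fix t assume t: "t \<in> {0<..T}"
  \<comment> \<open>The bound is available only away from time 0; times close to t stay above t/2,
    so a single constant serves in the limit.\<close>
  have "sobolev_bounded \<theta> (s + 2 * r) {t / 2..T} u" using t by (intro bdd) simp
  then obtain M where M: "M \<ge> 0" "\<And>x. x \<in> {t / 2..T} \<Longrightarrow> u x \<in> sobolev \<theta> (s + 2 * r)"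
      "\<And>x. x \<in> {t / 2..T} \<Longrightarrow> sobolev_norm \<theta> (s + 2 * r) (u x) \<le> M"
    by (rule sobolev_boundedE) (rule that)
  have t2: "t \<in> {t / 2..T}" using t by auto
  show "u t \<in> sobolev \<theta> (s + r)"
    by (rule sobolev_mono(1)[OF M(2)[OF t2]]) (use r in simp)
  have lim: "((\<lambda>x. sobolev_norm \<theta> s (u x - u t)) \<longlongrightarrow> 0) (at t within {0<..T})"
  proof (rule tendsto_within_subset)
    show "((\<lambda>x. sobolev_norm \<theta> s (u x - u t)) \<longlongrightarrow> 0) (at t within {0..T})"
      using u t by (simp add: sobolev_continuous_on_def)
  qed auto
  have lim: "((\<lambda>x. sqrt (sobolev_norm \<theta> s (u x - u t) * (2 * M))) \<longlongrightarrow> 0) (at t within {0<..T})"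
    using tendsto_real_sqrt[OF tendsto_mult_left_zero[OF lim, of "2 * M"]] by simp
  show "((\<lambda>x. sobolev_norm \<theta> (s + r) (u x - u t)) \<longlongrightarrow> 0) (at t within {0<..T})"
  proof (rule tendsto_sandwich[OF _ _ tendsto_const lim])
    have "\<forall>\<^sub>F x in at t within {0<..T}. t / 2 < x"
      by (rule order_tendstoD(1)[OF tendsto_ident_at]) (use t in simp)
    moreover have "\<forall>\<^sub>F x in at t within {0<..T}. x \<in> {0<..T}"
      by (auto simp: eventually_at_filter)
    ultimately show "\<forall>\<^sub>F x in at t within {0<..T}. sobolev_norm \<theta> (s + r) (u x - u t)
        \<le> sqrt (sobolev_norm \<theta> s (u x - u t) * (2 * M))"
    proof eventually_elim
      case (elim x)
      then have x: "x \<in> {t / 2..T}" by auto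
      have "u x - u t \<in> sobolev \<theta> (s + 2 * r)"
        and le: "sobolev_norm \<theta> (s + 2 * r) (u x - u t) \<le> 2 * M"
        using sobolev_diff[OF M(2)[OF x] M(2)[OF t2]] M(3)[OF x] M(3)[OF t2] by auto
      moreover from this have "u x - u t \<in> sobolev \<theta> s"
        using sobolev_mono(1)[of "u x - u t" \<theta> "s + 2 * r" s] r by simp
      ultimately have "(sobolev_norm \<theta> ((s + (s + 2 * r)) / 2) (u x - u t))\<^sup>2
          \<le> sobolev_norm \<theta> s (u x - u t) * sobolev_norm \<theta> (s + 2 * r) (u x - u t)"
        by (intro sobolev_norm_interpolation)
      also have "\<dots> \<le> sobolev_norm \<theta> s (u x - u t) * (2 * M)"
        by (intro mult_left_mono le) simp
      also have "(s + (s + 2 * r)) / 2 = s + r" by simp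
      finally show ?case by (rule real_le_rsqrt)
    qed
  qed simp
qed

theorem corollary5p3:
  fixes \<theta> :: "('n::{finite,linorder}) torus_matrix"
    and k q :: nat
    and N :: "nat \<Rightarrow> nat"
    and b :: "nat \<Rightarrow> nat \<Rightarrow> nat \<Rightarrow> 'n torus_L2"
    and u0 :: "'n torus_L2"
    and u :: "real \<Rightarrow> 'n torus_L2"
  assumes skew: "transpose \<theta> = - \<theta>"
    and k: "k \<ge> 1" "real k > real CARD('n) / 2"
    and q: "q \<ge> 1"
    and coeffs: "\<And>\<nu> \<mu> j r. \<nu> \<le> q \<Longrightarrow> \<mu> \<in> {1..N \<nu>} \<Longrightarrow> j \<le> \<nu> \<Longrightarrow> r \<ge> 1 \<Longrightarrow>
                   b \<nu> \<mu> j \<in> sobolev \<theta> (real (k + r))"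
    and u0: "u0 \<in> sobolev \<theta> (real k)"
    and u: "\<And>T. 0 < T \<Longrightarrow> ereal T < max_existence_time \<theta> (real k) (nc_polynomial \<theta> q N b) u0 \<Longrightarrow>
              mild_solution \<theta> (real k) (nc_polynomial \<theta> q N b) u0 T u"
  shows "\<forall>r\<ge>1. \<forall>T. 0 < T \<and> ereal T < max_existence_time \<theta> (real k) (nc_polynomial \<theta> q N b) u0 \<longrightarrow>
           sobolev_continuous_on \<theta> (real (k + r)) {0<..T} u"
proof (intro allI impI)
  fix r :: nat and T :: real
  assume "0 < T \<and> ereal T < max_existence_time \<theta> (real k) (nc_polynomial \<theta> q N b) u0"
  then have mild: "mild_solution \<theta> (real k) (nc_polynomial \<theta> q N b) u0 T u" by (intro u) auto
  then have cont: "sobolev_continuous_on \<theta> (real k) {0..T} u" by (simp add: mild_solution_def)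
  have bdd: "sobolev_bounded \<theta> (real (k + j)) {\<epsilon>..T} u" if "\<epsilon> > 0" for j \<epsilon>
    using that
  proof (induction j arbitrary: \<epsilon>)
    case 0
    have "sobolev_bounded \<theta> (real k) {0..T} u"
      by (rule sobolev_continuous_on_imp_bounded[OF cont]) simp
    then obtain M where "\<And>t. t \<in> {0..T} \<Longrightarrow> u t \<in> sobolev \<theta> (real k) \<and> sobolev_norm \<theta> (real k) (u t) \<le> M"
      unfolding sobolev_bounded_def by blast
    with 0 show ?case unfolding sobolev_bounded_def by (intro exI[of _ M]) auto
  next
    case (Suc j)
    \<comment> \<open>Half of \<epsilon> is spent on the bound at the previous level, the other half
      is the waiting time \<delta> of the smoothing step.\<close>
    then have ub: "sobolev_bounded \<theta> (real (k + j)) {\<epsilon> / 2..T} u" by simp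
    have "sobolev_bounded \<theta> (real (k + j)) {\<epsilon> / 2..T} (\<lambda>t. nc_polynomial \<theta> q N b (u t))"
    proof (rule sobolev_bounded_nc_polynomial[OF _ ub])
      show "real (k + j) > real CARD('n) / 2" using k(2) by simp
      show "b \<nu> \<mu> i \<in> sobolev \<theta> (real (k + j))" if "\<nu> \<le> q" "\<mu> \<in> {1..N \<nu>}" "i \<le> \<nu>" for \<nu> \<mu> i
        \<comment> \<open>The coefficients are given in H^(k+r) for r \<ge> 1 only; going one level
          up and back down covers j = 0 as well.\<close>
        using sobolev_mono(1)[OF coeffs[OF that, of "Suc j"], of "real (k + j)"] by simp
    qed
    from sobolev_bounded_smoothing[OF mild _ _ ub this, of "\<epsilon> / 2"] Suc.prems
    show ?case by (simp add: add_ac)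
  qed
  have "sobolev_continuous_on \<theta> (real k + real r) {0<..T} u"
  proof (rule sobolev_continuous_on_interpolation[OF cont])
    show "sobolev_bounded \<theta> (real k + 2 * real r) {\<epsilon>..T} u" if "\<epsilon> > 0" for \<epsilon>
      using bdd[OF that, of "2 * r"] by simp
  qed simp
  then show "sobolev_continuous_on \<theta> (real (k + r)) {0<..T} u" by simp
qed

end
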